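(* Let $p$ be an odd prime, let $n\geq 1$ and $r>1$ be integers, and put $K=K_{n+1}^{\mathbb Z/p^r}(x_1,\dots,x_{n+1})$. Then in $K$ $$(x_1\cdots x_{n+1})^{p^{r+1}}=(x_1\cdots x_n)^{p^{r+1}}\,\gamma,$$ where $$\gamma\in \gamma_2\gamma_2\gamma_2(K)\,[\gamma_2(K)^p,\gamma_2\gamma_2(K)]\,(\gamma_2\gamma_2(K))^p$$ as well as $$\gamma\in \mathcal B_{n+1}\,[\mathcal B_{n+1},\gamma_2(K)^p]\,[\mathcal B_{n+1},\gamma_2\gamma_2(K)].$$
   Context: Conventions: $[x,y]=x^{-1}y^{-1}xy$ and $[g_1,\dots,g_k]=[[g_1,\dots,g_{k-1}],g_k]$ (left-normalized commutators). The Cohen group $K_n^{\mathbb Z/p^r}=K_n^{\mathbb Z/p^r}(x_1,\dots,x_n)$ is the quotient of the free group $F(x_1,\dots,x_n)$ of rank $n$ by (the normal closure of) all left-normalized commutators $[x_{i_1},\dots,x_{i_k}]$ such that $i_s=i_t$ for some $1\le s,t\le k$, $s\ne t$, together with the powers $x_i^{p^r}$, $i=1,\dots,n$. $\mathcal B_n$ denotes the subgroup (not normal in general) of $K_n^{\mathbb Z/p^r}$ generated by all left-normalized commutators $[x_{i_1},\dots,x_{i_k}]$ in the generators whose length $k$ is not of the form $p^t$, $t\ge 0$. For a group $G$, $\gamma_2(G)=[G,G]$, $\gamma_2\gamma_2(G)=\gamma_2(\gamma_2(G))$ and $\gamma_2\gamma_2\gamma_2(G)=\gamma_2(\gamma_2(\gamma_2(G)))$.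 For a subgroup $A$ and integer $m\ge 1$, $A^m$ is the subgroup generated by the $m$-th powers of elements of $A$; for subgroups $A,B$, $[A,B]$ is the subgroup generated by all $[a,b]$, $a\in A$, $b\in B$. Juxtaposition $ABC$ of subgroups denotes the set of products $abc$ with $a\in A$, $b\in B$, $c\in C$. *)

theory Defs
  imports "HOL-Algebra.Generated_Groups" "HOL-Computational_Algebra.Primes"
begin

section \<open>Free groups as groups of reduced words\<close>

text \<open>A letter \<open>(x, True)\<close> stands for the generator \<open>x\<close>, and \<open>(x, False)\<close> for its formal inverse.\<close>

type_synonym 'a letter = "'a \<times> bool"

definition letter_inv :: "'a letter \<Rightarrow> 'a letter" where
  "letter_inv l = (fst l, \<not> snd l)"

definition reduced_word :: "'a letter list \<Rightarrow> bool" where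
  "reduced_word = successively (\<lambda>l m. m \<noteq> letter_inv l)"

text \<open>Left multiplication of a reduced word by a single letter, cancelling if possible.\<close>

fun push_letter :: "'a letter \<Rightarrow> 'a letter list \<Rightarrow> 'a letter list" where
  "push_letter l [] = [l]"
| "push_letter l (m # w) = (if m = letter_inv l then w else l # m # w)"

definition free_group :: "'a set \<Rightarrow> 'a letter list monoid" where
  "free_group X =
     \<lparr> carrier = {w. reduced_word w \<and> set w \<subseteq> X \<times> UNIV},
       monoid.mult = (\<lambda>u v. foldr push_letter u v),
       monoid.one = [] \<rparr>"

definition free_gen :: "'a \<Rightarrow> 'a letter list" where
  "free_gen x = [(x, True)]"

lemma letter_inv_letter_inv [simp]: "letter_inv (letter_inv l) = l"
  by (simp add: letter_inv_def)

lemma letter_inv_neq [simp]: "letter_inv l \<noteq> l" "l \<noteq> letter_inv l"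
  by (cases l; simp add: letter_inv_def)+

lemma reduced_word_Nil [simp]: "reduced_word []"
  by (simp add: reduced_word_def)

lemma reduced_word_Cons:
  "reduced_word (l # w) \<longleftrightarrow> reduced_word w \<and> (w = [] \<or> hd w \<noteq> letter_inv l)"
  by (auto simp: reduced_word_def successively_Cons)

lemma reduced_push_letter: "reduced_word w \<Longrightarrow> reduced_word (push_letter l w)"
  by (cases w) (auto simp: reduced_word_Cons)

lemma reduced_foldr_push: "reduced_word v \<Longrightarrow> reduced_word (foldr push_letter u v)"
  by (induction u) (auto simp: reduced_push_letter)

lemma set_push_letter: "set (push_letter l w) \<subseteq> insert l (set w)"
  by (cases w) auto

lemma set_foldr_push: "set (foldr push_letter u v) \<subseteq> set u \<union> set v"
  by (induction u) (use set_push_letter in fastforce)+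

lemma push_push_inv:
  assumes "reduced_word w"
  shows "push_letter l (push_letter (letter_inv l) w) = w"
proof (cases w)
  case (Cons m v)
  with assms show ?thesis by (cases v) (auto simp: reduced_word_Cons)
qed simp

lemma foldr_push_push:
  assumes "reduced_word w"
  shows "foldr push_letter (push_letter l v) w = push_letter l (foldr push_letter v w)"
  using assms by (cases v) (auto simp: push_push_inv reduced_foldr_push)

lemma foldr_push_assoc:
  assumes "reduced_word w"
  shows "foldr push_letter (foldr push_letter u v) w
         = foldr push_letter u (foldr push_letter v w)"
  by (induction u) (auto simp: foldr_push_push assms)

lemma foldr_push_Nil: "reduced_word w \<Longrightarrow> foldr push_letter w [] = w"
proof (induction w)
  case (Cons l w)
  then show ?case by (cases w) (auto simp: reduced_word_Cons)
qed simp

lemma foldr_push_inverse: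
  "reduced_word v \<Longrightarrow> foldr push_letter (rev (map letter_inv w)) (foldr push_letter w v) = v"
proof (induction w arbitrary: v)
  case (Cons l w)
  have "push_letter (letter_inv l) (push_letter l (foldr push_letter w v)) = foldr push_letter w v"
    using push_push_inv[of "foldr push_letter w v" "letter_inv l"] Cons.prems
    by (simp add: reduced_foldr_push)
  with Cons show ?case by simp
qed simp

theorem group_free_group: "group (free_group X)"
proof (rule groupI)
  fix u assume u: "u \<in> carrier (free_group X)"
  define i where "i = foldr push_letter (rev (map letter_inv u)) []"
  have "reduced_word i"
    unfolding i_def by (rule reduced_foldr_push) simp
  moreover have "set i \<subseteq> X \<times> UNIV"
    using set_foldr_push[of "rev (map letter_inv u)" "[]"] u
    by (fastforce simp: i_def free_group_def letter_inv_def)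
  moreover have "foldr push_letter i u = []"
  proof -
    have "foldr push_letter i u = foldr push_letter (rev (map letter_inv u)) u"
      using u foldr_push_assoc[of u "rev (map letter_inv u)" "[]"]
      by (simp add: i_def free_group_def)
    also have "\<dots> = foldr push_letter (rev (map letter_inv u)) (foldr push_letter u [])"
      using u by (simp add: foldr_push_Nil free_group_def)
    also have "\<dots> = []"
      by (rule foldr_push_inverse) simp
    finally show ?thesis .
  qed
  ultimately show "\<exists>v\<in>carrier (free_group X). v \<otimes>\<^bsub>free_group X\<^esub> u = \<one>\<^bsub>free_group X\<^esub>"
    by (auto simp: free_group_def)
next
  fix u v assume "u \<in> carrier (free_group X)" "v \<in> carrier (free_group X)"
  then show "u \<otimes>\<^bsub>free_group X\<^esub> v \<in> carrier (free_group X)"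
    using set_foldr_push[of u v] by (auto simp: free_group_def reduced_foldr_push)
qed (auto simp: free_group_def foldr_push_assoc reduced_word_def)

lemma free_gen_closed: "x \<in> X \<Longrightarrow> free_gen x \<in> carrier (free_group X)"
  by (simp add: free_group_def free_gen_def reduced_word_def)

text \<open>The universal property (existence part; the homomorphism is unique on reduced words).\<close>

theorem free_group_universal:
  fixes G (structure)
  assumes "group G" and f: "f \<in> X \<rightarrow> carrier G"
  shows "\<exists>h \<in> hom (free_group X) G. \<forall>x\<in>X. h (free_gen x) = f x"
proof -
  interpret group G by fact
  define lt where "lt l = (if snd l then f (fst l) else inv (f (fst l)))" for l
  define h where "h w = foldr (\<lambda>l g. lt l \<otimes> g) w \<one>" for w
  have lt_closed: "lt l \<in> carrier G" if "fst l \<in> X" for l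
    using that f by (auto simp: lt_def)
  have h_Nil: "h [] = \<one>" and h_Cons: "h (l # w) = lt l \<otimes> h w" for l w
    by (simp_all add: h_def)
  have h_closed: "h w \<in> carrier G" if "set w \<subseteq> X \<times> UNIV" for w
    using that by (induction w) (auto simp: h_Nil h_Cons lt_closed)
  have lt_inv: "lt l \<otimes> lt (letter_inv l) = \<one>" if "fst l \<in> X" for l
  proof -
    have "f (fst l) \<in> carrier G" using that f by auto
    then show ?thesis by (simp add: lt_def letter_inv_def)
  qed
  have h_push: "h (push_letter l w) = lt l \<otimes> h w"
    if l: "fst l \<in> X" and w: "set w \<subseteq> X \<times> UNIV" for l w
  proof (cases w)
    case (Cons m v)
    have v: "h v \<in> carrier G" using w Cons by (auto intro: h_closed)
    have "lt l \<otimes> (lt (letter_inv l) \<otimes> h v) = h v"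
      using m_assoc[symmetric, of "lt l" "lt (letter_inv l)" "h v"] lt_closed[of "letter_inv l"]
        lt_closed[OF l] lt_inv[OF l] v l by (simp add: letter_inv_def)
    with Cons show ?thesis by (auto simp: h_Cons)
  qed (simp add: h_Cons h_Nil)
  have h_mult: "h (foldr push_letter u v) = h u \<otimes> h v"
    if u: "set u \<subseteq> X \<times> UNIV" and v: "set v \<subseteq> X \<times> UNIV" for u v
    using u
  proof (induction u)
    case (Cons l u)
    have "set (foldr push_letter u v) \<subseteq> X \<times> UNIV"
      using set_foldr_push[of u v] Cons.prems v by auto
    moreover have "fst l \<in> X" "set u \<subseteq> X \<times> UNIV" using Cons.prems by auto
    ultimately show ?case
      using Cons.IH h_closed v by (simp add: h_push h_Cons m_assoc lt_closed)
  qed (simp add: h_Nil h_closed v)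
  have "h \<in> hom (free_group X) G"
    by (auto simp: hom_def free_group_def h_closed h_mult)
  moreover have "h (free_gen x) = f x" if "x \<in> X" for x
    using f[THEN funcset_mem, OF that] by (simp add: free_gen_def h_Cons h_Nil lt_def)
  ultimately show ?thesis by blast
qed


section \<open>Commutators, subgroups and normal closures\<close>

definition commutator :: "('a, 'b) monoid_scheme \<Rightarrow> 'a \<Rightarrow> 'a \<Rightarrow> 'a" where
  "commutator G x y = inv\<^bsub>G\<^esub> x \<otimes>\<^bsub>G\<^esub> inv\<^bsub>G\<^esub> y \<otimes>\<^bsub>G\<^esub> x \<otimes>\<^bsub>G\<^esub> y"

text \<open>\<open>ln_commutator G [g\<^sub>1, \<dots>, g\<^sub>k] = [[\<dots>[g\<^sub>1, g\<^sub>2], \<dots>], g\<^sub>k]\<close>; in particular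
  \<open>ln_commutator G [g] = g\<close>. The value on the empty list is a dummy.\<close>

fun ln_commutator :: "('a, 'b) monoid_scheme \<Rightarrow> 'a list \<Rightarrow> 'a" where
  "ln_commutator G [] = \<one>\<^bsub>G\<^esub>"
| "ln_commutator G (g # gs) = foldl (commutator G) g gs"

definition commutator_subgroup :: "('a, 'b) monoid_scheme \<Rightarrow> 'a set \<Rightarrow> 'a set \<Rightarrow> 'a set" where
  "commutator_subgroup G A B = generate G {commutator G a b | a b. a \<in> A \<and> b \<in> B}"

definition power_subgroup :: "('a, 'b) monoid_scheme \<Rightarrow> 'a set \<Rightarrow> nat \<Rightarrow> 'a set" where
  "power_subgroup G A m = generate G {a [^]\<^bsub>G\<^esub> m | a. a \<in> A}"

definition normal_closure :: "('a, 'b) monoid_scheme \<Rightarrow> 'a set \<Rightarrow> 'a set" where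
  "normal_closure G S =
     generate G {g \<otimes>\<^bsub>G\<^esub> s \<otimes>\<^bsub>G\<^esub> inv\<^bsub>G\<^esub> g | g s. g \<in> carrier G \<and> s \<in> S}"

lemma (in group) commutator_closed:
  "x \<in> carrier G \<Longrightarrow> y \<in> carrier G \<Longrightarrow> commutator G x y \<in> carrier G"
  by (simp add: commutator_def)

lemma (in group) ln_commutator_closed:
  assumes "set gs \<subseteq> carrier G"
  shows "ln_commutator G gs \<in> carrier G"
proof -
  have "foldl (commutator G) g hs \<in> carrier G" if "g \<in> carrier G" "set hs \<subseteq> carrier G" for g hs
    using that by (induction hs arbitrary: g) (auto simp: commutator_closed)
  with assms show ?thesis by (cases gs) auto
qed

text \<open>The library's \<^const>\<open>derived\<close> uses the convention \<open>x y x\<^sup>-\<^sup>1 y\<^sup>-\<^sup>1\<close> for commutators; on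
  subgroups this gives the same derived subgroup.\<close>

lemma (in group) derived_eq_commutator_subgroup:
  assumes "subgroup H G"
  shows "derived G H = commutator_subgroup G H H"
proof -
  interpret H: subgroup H G by fact
  have "derived_set G H = {commutator G a b | a b. a \<in> H \<and> b \<in> H}" (is "?L = ?R")
  proof (intro equalityI subsetI)
    fix g assume "g \<in> ?L"
    then obtain a b where "a \<in> H" "b \<in> H" "g = a \<otimes> b \<otimes> inv a \<otimes> inv b" by blast
    then have "inv a \<in> H \<and> inv b \<in> H \<and> g = commutator G (inv a) (inv b)"
      by (simp add: commutator_def)
    then show "g \<in> ?R" by blast
  next
    fix g assume "g \<in> ?R"
    then obtain a b where "a \<in> H" "b \<in> H" "g = commutator G a b" by blast
    then have "inv a \<in> H \<and> inv b \<in> H \<and> g = inv a \<otimes> inv b \<otimes> inv (inv a) \<otimes> inv (inv b)"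
      by (simp add: commutator_def)
    then show "g \<in> ?L" by blast
  qed
  then show ?thesis by (simp add: derived_def commutator_subgroup_def)
qed

lemma (in group) normal_closure_normal:
  assumes S: "S \<subseteq> carrier G"
  shows "normal_closure G S \<lhd> G" and "S \<subseteq> normal_closure G S"
    and "\<And>N. N \<lhd> G \<Longrightarrow> S \<subseteq> N \<Longrightarrow> normal_closure G S \<subseteq> N"
proof -
  show "normal_closure G S \<lhd> G"
    unfolding normal_closure_def
  proof (rule normal_generateI)
    show "{g \<otimes> s \<otimes> inv g | g s. g \<in> carrier G \<and> s \<in> S} \<subseteq> carrier G"
      using S by auto
  next
    fix h k
    assume "h \<in> {g \<otimes> s \<otimes> inv g | g s. g \<in> carrier G \<and> s \<in> S}" and k: "k \<in> carrier G"
    then obtain g s where g: "g \<in> carrier G" and s: "s \<in> S" and h: "h = g \<otimes> s \<otimes> inv g"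
      by blast
    have "k \<otimes> h \<otimes> inv k = (k \<otimes> g) \<otimes> s \<otimes> inv (k \<otimes> g)"
      using g k s S by (auto simp: h m_assoc inv_mult_group subset_eq)
    with g k s show "k \<otimes> h \<otimes> inv k \<in> {g \<otimes> s \<otimes> inv g | g s. g \<in> carrier G \<and> s \<in> S}"
      by blast
  qed
  show "S \<subseteq> normal_closure G S"
  proof
    fix s assume s: "s \<in> S"
    then have "s = \<one> \<otimes> s \<otimes> inv \<one>" using S by auto
    with s show "s \<in> normal_closure G S"
      unfolding normal_closure_def by (intro generate.incl) blast
  qed
  show "normal_closure G S \<subseteq> N" if N: "N \<lhd> G" and SN: "S \<subseteq> N" for N
    unfolding normal_closure_def
  proof (rule generate_subgroup_incl)
    show "{g \<otimes> s \<otimes> inv g | g s. g \<in> carrier G \<and> s \<in> S} \<subseteq> N"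
      using normal.inv_op_closed2[OF N] SN by blast
    show "subgroup N G" using N by (rule normal_imp_subgroup)
  qed
qed


section \<open>The Cohen group\<close>

text \<open>The free generators \<open>x\<^sub>1, \<dots>, x\<^sub>n\<close> are indexed by \<open>{1..n}\<close>; \<open>q\<close> is the exponent \<open>p\<^sup>r\<close>.\<close>

definition cohen_relators :: "nat \<Rightarrow> nat \<Rightarrow> nat letter list set" where
  "cohen_relators n q = (let F = free_group {1..n} in
     {ln_commutator F (map free_gen is) | is. set is \<subseteq> {1..n} \<and> \<not> distinct is}
     \<union> {free_gen i [^]\<^bsub>F\<^esub> q | i. i \<in> {1..n}})"

definition cohen_kernel :: "nat \<Rightarrow> nat \<Rightarrow> nat letter list set" where
  "cohen_kernel n q = normal_closure (free_group {1..n}) (cohen_relators n q)"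

definition cohen_group :: "nat \<Rightarrow> nat \<Rightarrow> nat letter list set monoid" where
  "cohen_group n q = free_group {1..n} Mod cohen_kernel n q"

definition cohen_gen :: "nat \<Rightarrow> nat \<Rightarrow> nat \<Rightarrow> nat letter list set" where
  "cohen_gen n q i = cohen_kernel n q #>\<^bsub>free_group {1..n}\<^esub> free_gen i"

text \<open>The product \<open>x\<^sub>1 \<cdots> x\<^sub>m\<close> in the Cohen group on \<open>n \<ge> m\<close> generators.\<close>

definition cohen_prod :: "nat \<Rightarrow> nat \<Rightarrow> nat \<Rightarrow> nat letter list set" where
  "cohen_prod n q m =
     foldr (\<lambda>i g. cohen_gen n q i \<otimes>\<^bsub>cohen_group n q\<^esub> g) [1..<Suc m] \<one>\<^bsub>cohen_group n q\<^esub>"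

text \<open>The subgroup \<open>\<B>\<^sub>n\<close> of the Cohen group on \<open>n\<close> generators of order \<open>p\<^sup>r\<close>.\<close>

definition cohen_B :: "nat \<Rightarrow> nat \<Rightarrow> nat \<Rightarrow> nat letter list set set" where
  "cohen_B p r n = generate (cohen_group n (p ^ r))
     {ln_commutator (cohen_group n (p ^ r)) (map (cohen_gen n (p ^ r)) is) | is.
        is \<noteq> [] \<and> set is \<subseteq> {1..n} \<and> (\<nexists>t. length is = p ^ t)}"

lemma cohen_relators_closed: "cohen_relators n q \<subseteq> carrier (free_group {1..n})"
proof -
  interpret F: group "free_group {1..n}" by (rule group_free_group)
  have "ln_commutator (free_group {1..n}) gs \<in> carrier (free_group {1..n})"
    if "set gs \<subseteq> carrier (free_group {1..n})" for gs
    using that by (rule F.ln_commutator_closed)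
  moreover have "set (map free_gen is) \<subseteq> carrier (free_group {1..n})" if "set is \<subseteq> {1..n}" for "is"
    using that free_gen_closed[of _ "{1..n}"] by (auto simp del: atLeastAtMost_iff)
  moreover have "free_gen i [^]\<^bsub>free_group {1..n}\<^esub> q \<in> carrier (free_group {1..n})" if "i \<in> {1..n}" for i
    using free_gen_closed[OF that] by (rule F.nat_pow_closed)
  ultimately show ?thesis
    unfolding cohen_relators_def Let_def by blast
qed

lemma cohen_kernel_normal: "cohen_kernel n q \<lhd> free_group {1..n}"
  unfolding cohen_kernel_def
  by (rule group.normal_closure_normal(1)[OF group_free_group cohen_relators_closed])

theorem group_cohen_group: "group (cohen_group n q)"
  unfolding cohen_group_def by (rule normal.factorgroup_is_group[OF cohen_kernel_normal])

lemma cohen_gen_closed: "i \<in> {1..n} \<Longrightarrow> cohen_gen n q i \<in> carrier (cohen_group n q)"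
  using free_gen_closed[of i "{1..n}"]
  by (auto simp: cohen_gen_def cohen_group_def FactGroup_def RCOSETS_def)

end

theory Submission
  imports Defs "HOL.Modules" "HOL-Algebra.Free_Abelian_Groups" "HOL-Algebra.SndIsomorphismGrp"
begin

text \<open>Let \<open>x\<close> be the last generator, \<open>y\<close> the product of the others, and \<open>A\<close> the normal closure of
  \<open>x\<close>. Commutators with a repeated letter are trivial, so \<open>A\<close> is abelian and \<open>K\<close> acts on it by
  conjugation; written additively, a commutator \<open>[a, k]\<close> becomes \<open>a (k - 1)\<close>. With
  \<open>Y = y - 1\<close> and \<open>q = p ^ (r + 1)\<close> the usual expansion of \<open>(y x) ^ q\<close> gives

  \<open>\<gamma> = \<Sum>k=1..q. (q choose k) x Y ^ (k - 1)\<close>.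

  If \<open>p ^ s\<close> is the exact power of \<open>p\<close> in \<open>k\<close>, then \<open>p ^ (r + 1 - s)\<close> divides the coefficient. As
  \<open>A\<close> has exponent dividing \<open>p ^ r\<close>, only terms with \<open>s \<ge> 2\<close> matter.

  Powers of \<open>Y\<close> are controlled by the congruence \<open>(1 + Y) ^ (p ^ t) \<equiv> 1 + Y ^ (p ^ t)\<close> modulo \<open>p\<close>, that
  is, by the action of \<open>y ^ (p ^ t)\<close>. Let \<open>V\<close> be generated by the commutators \<open>[x, x\<^sub>i, \<dots>]\<close> of length at
  least 2 and put \<open>U = [V, \<gamma>\<^sub>2]\<close>. On \<open>V / (U + p V)\<close> the group acts through an abelian
  group in which the generators have order dividing \<open>p\<close>, hence \<open>V Y ^ p \<subseteq> U + p V\<close>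
  (\<open>frobenius_proper_words\<close>). On \<open>U / (p U + [U, \<gamma>\<^sub>2\<^sub>2])\<close> the image of \<open>\<gamma>\<^sub>2\<close> is
  elementary abelian, because \<open>(c - 1) ^ 2 = 0\<close> for every left-normalized commutator \<open>c\<close>; hence
  \<open>U Y ^ (p ^ 2) \<subseteq> p U + [U, \<gamma>\<^sub>2\<^sub>2]\<close> (\<open>frobenius_bracketed\<close>). For \<open>2 \<le> s \<le> r\<close> there are
  enough factors \<open>Y ^ p\<close> to send the term into \<open>p U\<close>, and for \<open>k = q\<close> there are enough factors to send
  it first into \<open>U\<close> and then into \<open>p U + [U, \<gamma>\<^sub>2\<^sub>2]\<close>. So \<open>\<gamma>\<close> lies in
  \<open>p U + [U, \<gamma>\<^sub>2\<^sub>2]\<close> (\<open>error_term_in_deep_level\<close>), and the first membership follows from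
  \<open>U \<subseteq> \<gamma>\<^sub>2\<^sub>2\<close>.

  For the second membership, \<open>p U\<close> is generated by the \<open>[a, c] ^ p\<close> with \<open>a\<close> and \<open>c\<close> left-normalized
  commutators of lengths \<open>m\<close> and \<open>d\<close>. Such an element is a combination of left-normalized
  commutators of length \<open>m + d\<close>, hence in \<open>\<B>\<close> unless \<open>m + d\<close> is a power of \<open>p\<close>. In that case \<open>m\<close> and
  \<open>d\<close> are not both powers of \<open>p\<close>, since a sum of two odd numbers is not odd. So one of
  \<open>a\<close>, \<open>c\<close> is in \<open>\<B>\<close>, and moving the exponent to the other one shows \<open>[a, c] ^ p \<in> [\<B>, \<gamma>\<^sub>2 ^ p]\<close>. The
  part \<open>[U, \<gamma>\<^sub>2\<^sub>2]\<close> is treated in the same way; there the element of \<open>\<gamma>\<^sub>2\<^sub>2\<close> is replaced by a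
  combination of left-normalized commutators with the same action, which is the Jacobi identity.\<close>

section \<open>Commutators and normal subgroups\<close>

context group
begin

lemma inv_mult_cancel:
  assumes "x \<in> carrier G" "y \<in> carrier G"
  shows "inv x \<otimes> (x \<otimes> y) = y" "x \<otimes> (inv x \<otimes> y) = y"
  using assms by (simp_all add: m_assoc[symmetric])

lemmas group_word_simps = commutator_def m_assoc inv_mult_group inv_mult_cancel

lemma commutator_eq_one_iff:
  assumes "a \<in> carrier G" "b \<in> carrier G"
  shows "commutator G a b = \<one> \<longleftrightarrow> a \<otimes> b = b \<otimes> a"
proof -
  have "(b \<otimes> a) \<otimes> commutator G a b = a \<otimes> b"
    using assms by (simp add: group_word_simps)
  then show ?thesis
    using assms l_cancel_one[of "b \<otimes> a" "commutator G a b"]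
    by (auto simp: commutator_closed)
qed

lemma inv_commutator:
  assumes "a \<in> carrier G" "b \<in> carrier G"
  shows "inv (commutator G a b) = commutator G b a"
  using assms by (simp add: group_word_simps)

lemma conjugate_eq_mult_commutator:
  assumes "a \<in> carrier G" "b \<in> carrier G"
  shows "inv b \<otimes> a \<otimes> b = a \<otimes> commutator G a b"
  using assms by (simp add: group_word_simps)

text \<open>Both \<open>x\<close> and its inverse occur in the condition: for infinite \<open>H\<close>, conjugation by \<open>x\<close> can map \<open>H\<close>
  properly into itself.\<close>

lemma normal_if_generators_conjugate:
  assumes gen: "carrier G = generate G X" and X: "X \<subseteq> carrier G" and H: "subgroup H G"
    and conj: "\<And>h x. h \<in> H \<Longrightarrow> x \<in> X \<Longrightarrow> inv x \<otimes> h \<otimes> x \<in> H \<and> x \<otimes> h \<otimes> inv x \<in> H"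
  shows "H \<lhd> G"
proof (rule normal_invI[OF H])
  interpret H: subgroup H G by fact
  have "k \<in> carrier G \<and> (\<forall>h\<in>H. inv k \<otimes> h \<otimes> k \<in> H \<and> k \<otimes> h \<otimes> inv k \<in> H)"
    if "k \<in> generate G X" for k
    using that
  proof induction
    case (incl x) then show ?case using conj X by auto
  next
    case (inv x) then show ?case using conj X by auto
  next
    case (eng a b)
    have "inv (a \<otimes> b) \<otimes> h \<otimes> (a \<otimes> b) = inv b \<otimes> (inv a \<otimes> h \<otimes> a) \<otimes> b"
      "(a \<otimes> b) \<otimes> h \<otimes> inv (a \<otimes> b) = a \<otimes> (b \<otimes> h \<otimes> inv b) \<otimes> inv a" if "h \<in> H" for h
      using eng that by (simp_all add: group_word_simps)
    then show ?case using eng by auto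
  qed auto
  then show "x \<otimes> h \<otimes> inv x \<in> H" if "x \<in> carrier G" "h \<in> H" for x h
    using that unfolding gen by blast
qed

lemma commutator_in_normal:
  assumes "N \<lhd> G" "a \<in> carrier G" "b \<in> carrier G"
  shows "a \<in> N \<Longrightarrow> commutator G a b \<in> N" and "b \<in> N \<Longrightarrow> commutator G a b \<in> N"
proof -
  interpret N: normal N G by fact
  show "commutator G a b \<in> N" if a: "a \<in> N"
  proof -
    have "commutator G a b = inv a \<otimes> (inv b \<otimes> a \<otimes> b)"
      using assms by (simp add: group_word_simps)
    then show ?thesis using a N.inv_op_closed1[OF assms(3) a] by simp
  qed
  show "commutator G a b \<in> N" if b: "b \<in> N"
  proof -
    have "commutator G a b = (inv a \<otimes> inv b \<otimes> a) \<otimes> b"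
      using assms by (simp add: group_word_simps)
    then show ?thesis using b N.inv_op_closed1[OF assms(2), of "inv b"] by simp
  qed
qed

text \<open>The kernel of the action of \<open>G\<close> on \<open>T / S\<close>, when \<open>S \<subseteq> T\<close> are normal.\<close>

definition relative_centralizer :: "'a set \<Rightarrow> 'a set \<Rightarrow> 'a set" where
  "relative_centralizer T S = {k \<in> carrier G. \<forall>t\<in>T. commutator G t k \<in> S}"

lemma subgroup_relative_centralizer:
  assumes S: "S \<lhd> G" and T: "T \<subseteq> carrier G"
  shows "subgroup (relative_centralizer T S) G"
proof -
  interpret S: normal S G by fact
  have mult: "commutator G t (k \<otimes> l) = commutator G t l \<otimes> (inv l \<otimes> commutator G t k \<otimes> l)"
    and inv: "commutator G t (inv k) = k \<otimes> inv (commutator G t k) \<otimes> inv k"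
    if "t \<in> carrier G" "k \<in> carrier G" "l \<in> carrier G" for t k l
    using that by (simp_all add: group_word_simps)
  show ?thesis
  proof (rule subgroupI)
    show "relative_centralizer T S \<noteq> {}"
      using T by (auto simp: relative_centralizer_def commutator_def subset_eq intro!: exI[of _ \<one>])
  qed (use T mult inv S.inv_op_closed1 S.inv_op_closed2 in
      \<open>auto simp: relative_centralizer_def subset_eq\<close>)
qed

lemma normal_relative_centralizer:
  assumes S: "S \<lhd> G" and T: "T \<lhd> G"
  shows "relative_centralizer T S \<lhd> G"
proof (rule normal_invI)
  interpret S: normal S G by fact
  interpret T: normal T G by fact
  show "subgroup (relative_centralizer T S) G"
    using subgroup_relative_centralizer[OF S T.subset] .
  fix a k assume a: "a \<in> carrier G" and k: "k \<in> relative_centralizer T S"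
  then have kG: "k \<in> carrier G" by (simp add: relative_centralizer_def)
  have "commutator G t (a \<otimes> k \<otimes> inv a) = a \<otimes> commutator G (inv a \<otimes> t \<otimes> a) k \<otimes> inv a"
    if "t \<in> carrier G" for t
    using that a kG by (simp add: group_word_simps)
  moreover have "inv a \<otimes> t \<otimes> a \<in> T" if "t \<in> T" for t
    using T.inv_op_closed1[OF a that] .
  ultimately show "a \<otimes> k \<otimes> inv a \<in> relative_centralizer T S"
    using a k S.inv_op_closed2 by (auto simp: relative_centralizer_def)
qed

text \<open>Commuting modulo \<open>P\<close> with a fixed element is a subgroup condition, so it extends from \<open>L\<close> to the
  generated subgroup, first in one argument and then in the other.\<close>

lemma derived_generate_subset:
  assumes P: "P \<lhd> G" and L: "L \<subseteq> carrier G"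
    and comm: "\<And>a b. a \<in> L \<Longrightarrow> b \<in> L \<Longrightarrow> commutator G a b \<in> P"
  shows "derived G (generate G L) \<subseteq> P"
proof -
  interpret P: normal P G by fact
  let ?D = "generate G L"
  have D: "?D \<subseteq> carrier G" using L by (rule generate_incl)
  have "?D \<subseteq> relative_centralizer L P"
    using comm L
    by (intro generate_subgroup_incl subgroup_relative_centralizer[OF P])
      (auto simp: relative_centralizer_def)
  then have "commutator G a b \<in> P" if "a \<in> ?D" "b \<in> L" for a b
    using that L D P.m_inv_closed[of "commutator G b a"] inv_commutator[of b a]
    by (auto simp: relative_centralizer_def subset_eq)
  then have "?D \<subseteq> relative_centralizer ?D P"
    using L D
    by (intro generate_subgroup_incl[OF _ subgroup_relative_centralizer[OF P D]])
      (auto simp: relative_centralizer_def)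
  then show ?thesis
    unfolding derived_eq_commutator_subgroup[OF generate_is_subgroup[OF L]] commutator_subgroup_def
    by (intro generate_subgroup_incl) (auto simp: relative_centralizer_def P.subgroup_axioms)
qed

text \<open>Modulo \<open>P\<close> the elements \<open>a\<close> and \<open>b\<close> commute, so the power of the product is the product of the
  powers.\<close>

lemma pow_mult_in_normal:
  fixes m :: nat
  assumes P: "P \<lhd> G" and ab: "a \<in> carrier G" "b \<in> carrier G"
    and comm: "commutator G a b \<in> P" and "a [^] m \<in> P" "b [^] m \<in> P"
  shows "(a \<otimes> b) [^] m \<in> P"
proof -
  interpret P: normal P G by fact
  have "\<exists>c\<in>P. b [^] k \<otimes> a = c \<otimes> (a \<otimes> b [^] k)" for k :: nat
  proof (induction k)
    case (Suc k)
    then obtain c where c: "c \<in> P" "b [^] k \<otimes> a = c \<otimes> (a \<otimes> b [^] k)" by blast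
    have "b [^] Suc k \<otimes> a = b [^] k \<otimes> (b \<otimes> a)"
      using ab by (simp add: m_assoc)
    also have "b \<otimes> a = a \<otimes> b \<otimes> inv (commutator G a b)"
      using ab by (simp add: group_word_simps)
    also have "b [^] k \<otimes> \<dots> = (b [^] k \<otimes> a) \<otimes> b \<otimes> inv (commutator G a b)"
      using ab by (simp add: m_assoc commutator_closed)
    also have "\<dots> = c \<otimes> ((a \<otimes> b [^] Suc k) \<otimes> inv (commutator G a b) \<otimes> inv (a \<otimes> b [^] Suc k))
          \<otimes> (a \<otimes> b [^] Suc k)"
      using ab c P.subset[THEN subsetD, OF c(1)] by (simp add: group_word_simps)
    finally show ?case
      using P.m_closed[OF c(1) P.inv_op_closed2[of "a \<otimes> b [^] Suc k" "inv (commutator G a b)"]]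
        comm ab P.m_inv_closed nat_pow_closed m_closed by metis
  qed (use ab in auto)
  then have "\<exists>c\<in>P. (a \<otimes> b) [^] k = c \<otimes> (a [^] k \<otimes> b [^] k)" for k :: nat
  proof (induction k)
    case (Suc k)
    then obtain c d where c: "c \<in> P" "(a \<otimes> b) [^] k = c \<otimes> (a [^] k \<otimes> b [^] k)"
      and d: "d \<in> P" "b [^] k \<otimes> a = d \<otimes> (a \<otimes> b [^] k)" by blast
    note [simp] = P.subset[THEN subsetD, OF c(1)] P.subset[THEN subsetD, OF d(1)]
    have "(a \<otimes> b) [^] Suc k = c \<otimes> a [^] k \<otimes> (b [^] k \<otimes> a) \<otimes> b"
      using ab c by (simp add: m_assoc)
    also have "\<dots> = c \<otimes> (a [^] k \<otimes> d \<otimes> inv (a [^] k)) \<otimes> (a [^] Suc k \<otimes> b [^] Suc k)"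
      using ab d by (simp add: group_word_simps)
    finally show ?case
      using P.m_closed[OF c(1) P.inv_op_closed2[of "a [^] k" d]] d(1) ab by blast
  qed auto
  from this[of m] assms show ?thesis by auto
qed

end

lemma set_multI: "a \<in> H \<Longrightarrow> b \<in> K \<Longrightarrow> a \<otimes>\<^bsub>G\<^esub> b \<in> H <#>\<^bsub>G\<^esub> K"
  by (auto simp: set_mult_def)

lemma (in group) subgroup_nat_pow_closed:
  assumes "subgroup H G" "h \<in> H"
  shows "h [^] (k::nat) \<in> H"
  using subgroup_int_pow_closed[OF assms, of "int k"] by (simp add: int_pow_int)

section \<open>Operators on the free module of words\<close>

text \<open>A word \<open>w\<close> stands for the commutator \<open>[x, x\<^sub>w]\<close>, and the free module on words maps onto the normal
  closure of \<open>x\<close>. Working in this free module gives additive notation and type-class automation for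
  computations in an abelian subgroup that is not a type.\<close>

type_synonym word_module = "nat list \<Rightarrow>\<^sub>0 int"

inductive_set add_span :: "'a::ab_group_add set \<Rightarrow> 'a set" for S where
  zero: "0 \<in> add_span S"
| base: "a \<in> S \<Longrightarrow> a \<in> add_span S"
| diff: "a \<in> add_span S \<Longrightarrow> b \<in> add_span S \<Longrightarrow> a - b \<in> add_span S"

lemma add_span_minus: "a \<in> add_span S \<Longrightarrow> - a \<in> add_span S"
  using add_span.diff[OF add_span.zero] by fastforce

lemma add_span_add: "a \<in> add_span S \<Longrightarrow> b \<in> add_span S \<Longrightarrow> a + b \<in> add_span S"
  using add_span.diff[of a S "- b"] add_span_minus[of b S] by simp

lemma add_span_cmul: "a \<in> add_span S \<Longrightarrow> frag_cmul c a \<in> add_span S"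
  by (rule frag_closure_minus_cmul) (auto intro: add_span.intros)

lemma add_span_image:
  assumes "a \<in> add_span S" and f: "additive f" and "\<And>s. s \<in> S \<Longrightarrow> f s \<in> add_span T"
  shows "f a \<in> add_span T"
  using assms(1)
  by induction (auto simp: additive.diff[OF f] additive.zero[OF f] assms intro: add_span.intros)

lemma add_span_Un_decompose:
  "m \<in> add_span (S \<union> T) \<Longrightarrow> \<exists>a\<in>add_span S. \<exists>b\<in>add_span T. m = a + b"
proof (induction rule: add_span.induct)
  case (diff m m')
  then obtain a b a' b' where *: "a \<in> add_span S" "b \<in> add_span T" "a' \<in> add_span S" "b' \<in> add_span T"
    "m = a + b" "m' = a' + b'" by blast
  then have "m - m' = (a - a') + (b - b')" by simp
  with * show ?case using add_span.diff by blast
next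
  case (base m)
  then show ?case
    using add_span.base[of m] add_span.zero by (metis Un_iff add.left_neutral add.right_neutral)
qed (use add_span.zero in force)

lemma additive_frag_cmul: "additive (frag_cmul c)"
  by standard (rule frag_cmul_distrib2)

lemma additive_cmul:
  assumes "additive (f :: word_module \<Rightarrow> word_module)"
  shows "f (frag_cmul c m) = frag_cmul c (f m)"
proof -
  interpret additive f by fact
  have "f (frag_cmul (int k) m) = frag_cmul (int k) (f m)" for k
    by (induction k) (auto simp: frag_cmul_distrib add zero)
  from this[of "nat c"] this[of "nat (- c)"] show ?thesis
    by (cases "c \<ge> 0") (auto simp: minus minus_frag_cmul[symmetric] simp del: minus_frag_cmul)
qed

definition append_letter :: "nat \<Rightarrow> word_module \<Rightarrow> word_module" where
  "append_letter i = frag_extend (\<lambda>w. frag_of (w @ [i]))"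

lemma append_letter_frag_of [simp]: "append_letter i (frag_of w) = frag_of (w @ [i])"
  by (simp add: append_letter_def)

lemma additive_append_letter: "additive (append_letter i)"
  by standard (simp add: append_letter_def frag_extend_add)

text \<open>Operators act on the right: the product \<open>f h\<close> is the function \<open>\<lambda>m. h (f m)\<close>, and this is the Lie
  bracket \<open>f h - h f\<close>.\<close>

definition bracket ::
  "(word_module \<Rightarrow> word_module) \<Rightarrow> (word_module \<Rightarrow> word_module) \<Rightarrow> word_module \<Rightarrow> word_module" where
  "bracket f h m = h (f m) - f (h m)"

lemma additive_bracket: "additive f \<Longrightarrow> additive h \<Longrightarrow> additive (bracket f h)"
  by (simp add: additive_def bracket_def)

text \<open>The operator by which the left-normalized commutator \<open>[x\<^sub>i, x\<^sub>j, \<dots>]\<close> acts (see \<open>acts_as_lnc\<close> below).\<close>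

fun ln_bracket :: "nat list \<Rightarrow> word_module \<Rightarrow> word_module" where
  "ln_bracket [] = (\<lambda>m. 0)"
| "ln_bracket (i # is) = foldl (\<lambda>f j. bracket f (append_letter j)) (append_letter i) is"

lemma ln_bracket_snoc: "is \<noteq> [] \<Longrightarrow> ln_bracket (is @ [j]) = bracket (ln_bracket is) (append_letter j)"
  by (cases "is") auto

lemma ln_bracket_single [simp]: "ln_bracket [i] = append_letter i"
  by simp

lemma additive_ln_bracket: "additive (ln_bracket is)"
proof (induction "is" rule: rev_induct)
  case Nil
  then show ?case by (simp add: additive_def)
next
  case (snoc i "is")
  then show ?case
    by (cases "is = []")
      (simp_all add: ln_bracket_snoc additive_bracket additive_append_letter del: ln_bracket.simps(2))
qed

text \<open>The homogeneous components. They record the length of a commutator, on which membership in \<open>\<B>\<close>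
  depends.\<close>

definition words_of_length :: "nat \<Rightarrow> word_module set" where
  "words_of_length d = {frag_of w | w. length w = d}"

lemma append_letter_words:
  "m \<in> add_span (words_of_length d) \<Longrightarrow> append_letter i m \<in> add_span (words_of_length (Suc d))"
  by (erule add_span_image[OF _ additive_append_letter])
    (auto simp: words_of_length_def intro!: add_span.base)

lemma bracket_words:
  assumes "\<And>d m. m \<in> add_span (words_of_length d) \<Longrightarrow> f m \<in> add_span (words_of_length (d + k))"
    and "\<And>d m. m \<in> add_span (words_of_length d) \<Longrightarrow> h m \<in> add_span (words_of_length (d + l))"
    and "m \<in> add_span (words_of_length d)"
  shows "bracket f h m \<in> add_span (words_of_length (d + (k + l)))"
  using assms(2)[OF assms(1)[OF assms(3)]] assms(1)[OF assms(2)[OF assms(3)]]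
  by (auto simp: bracket_def add_ac intro!: add_span.diff)

lemma ln_bracket_words:
  "m \<in> add_span (words_of_length d) \<Longrightarrow> ln_bracket is m \<in> add_span (words_of_length (d + length is))"
proof (induction "is" arbitrary: d m rule: rev_induct)
  case Nil
  then show ?case by (simp add: add_span.zero)
next
  case (snoc i "is")
  show ?case
  proof (cases "is = []")
    case True
    with snoc.prems show ?thesis
      by (simp add: append_letter_words del: ln_bracket.simps)
  next
    case False
    have "bracket (ln_bracket is) (append_letter i) m \<in> add_span (words_of_length (d + (length is + 1)))"
      by (rule bracket_words) (use snoc append_letter_words in auto)
    with False show ?thesis by (simp add: ln_bracket_snoc)
  qed
qed

text \<open>The homogeneous component of degree \<open>d\<close> of the Lie ring generated by the \<open>append_letter i\<close>, given as
  the additive span of its left-normalized brackets.\<close>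

inductive lie_operator :: "nat \<Rightarrow> (word_module \<Rightarrow> word_module) \<Rightarrow> bool" for d where
  zero: "lie_operator d (\<lambda>m. 0)"
| base: "length is = d \<Longrightarrow> lie_operator d (ln_bracket is)"
| diff: "lie_operator d f \<Longrightarrow> lie_operator d h \<Longrightarrow> lie_operator d (\<lambda>m. f m - h m)"

lemma lie_operator_bracket_letter:
  "lie_operator d f \<Longrightarrow> d \<ge> 1 \<Longrightarrow> lie_operator (Suc d) (bracket f (append_letter i))"
proof (induction rule: lie_operator.induct)
  case zero
  have "bracket (\<lambda>m. 0) (append_letter i) = (\<lambda>m. 0)"
    by (simp add: fun_eq_iff bracket_def additive.zero[OF additive_append_letter])
  then show ?case by (simp add: lie_operator.zero)
next
  case (base "is")
  then show ?case
    using lie_operator.base[of "is @ [i]" "Suc d"] by (cases "is = []") (auto simp: ln_bracket_snoc)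
next
  case (diff f h)
  have "bracket (\<lambda>m. f m - h m) (append_letter i)
      = (\<lambda>m. bracket f (append_letter i) m - bracket h (append_letter i) m)"
    by (simp add: fun_eq_iff bracket_def additive.diff[OF additive_append_letter])
  then show ?case using diff lie_operator.diff by simp
qed

text \<open>Left-normalized brackets span the Lie ring: the Jacobi identity moves the last letter of the second
  factor to the outside or to the first factor, and the second factor becomes shorter.\<close>

lemma lie_operator_bracket_ln_bracket:
  assumes "is \<noteq> []" "js \<noteq> []"
  shows "lie_operator (length is + length js) (bracket (ln_bracket is) (ln_bracket js))"
  using assms(2,1)
proof (induction js arbitrary: "is" rule: rev_nonempty_induct)
  case (single j)
  then show ?case
    using lie_operator.base[of "is @ [j]"] by (simp add: ln_bracket_snoc del: ln_bracket.simps(2))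
next
  case (snoc j js)
  let ?f = "ln_bracket is" and ?h = "ln_bracket js" and ?x = "append_letter j"
  have "bracket ?f (bracket ?h ?x)
      = (\<lambda>m. bracket (bracket ?f ?h) ?x m - bracket (bracket ?f ?x) ?h m)"
    by (simp add: fun_eq_iff bracket_def algebra_simps additive.diff[OF additive_ln_bracket]
        additive.diff[OF additive_append_letter])
  moreover have "lie_operator (length is + length (js @ [j])) (bracket (bracket ?f ?h) ?x)"
    using lie_operator_bracket_letter[OF snoc.IH[OF snoc.prems]] snoc.prems by (cases "is") auto
  moreover have "lie_operator (length is + length (js @ [j])) (bracket (bracket ?f ?x) ?h)"
    using snoc.IH[of "is @ [j]"] snoc.prems by (simp add: ln_bracket_snoc)
  ultimately show ?case
    using snoc.hyps by (simp add: ln_bracket_snoc lie_operator.diff)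
qed

lemma additive_funpow: "additive f \<Longrightarrow> additive (f ^^ k)"
  for f :: "'a::ab_group_add \<Rightarrow> 'a"
  by (induction k) (auto simp: additive_def)

text \<open>The binomial theorem for the commuting operators \<open>1\<close> and \<open>f\<close>.\<close>

lemma funpow_one_plus:
  fixes f :: "word_module \<Rightarrow> word_module"
  assumes "additive f"
  shows "((\<lambda>m. m + f m) ^^ k) m = (\<Sum>j\<le>k. frag_cmul (int (k choose j)) ((f ^^ j) m))"
proof (induction k)
  case (Suc k)
  let ?t = "\<lambda>j. (f ^^ j) m"
  have "((\<lambda>m. m + f m) ^^ Suc k) m
      = (\<Sum>j\<le>k. frag_cmul (int (k choose j)) (?t j)) + (\<Sum>j\<le>k. frag_cmul (int (k choose j)) (?t (Suc j)))"
    using Suc by (simp add: additive.sum[OF assms] additive_cmul[OF assms])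
  also have "(\<Sum>j\<le>k. frag_cmul (int (k choose j)) (?t j))
      = ?t 0 + (\<Sum>j\<le>k. frag_cmul (int (k choose Suc j)) (?t (Suc j)))"
    using sum.atMost_Suc_shift[of "\<lambda>j. frag_cmul (int (k choose j)) (?t j)" k]
    by (simp add: binomial_eq_0)
  also have "\<dots> + (\<Sum>j\<le>k. frag_cmul (int (k choose j)) (?t (Suc j)))
      = (\<Sum>j\<le>Suc k. frag_cmul (int (Suc k choose j)) (?t j))"
    by (subst sum.atMost_Suc_shift) (simp add: sum.distrib frag_cmul_distrib algebra_simps)
  finally show ?case .
qed simp

section \<open>Groups in which repeated letters kill commutators\<close>

text \<open>The generators are indexed by all natural numbers; a finitely generated group is covered by setting
  the other generators to \<open>\<one>\<close>, and no range conditions on letters occur. The index \<open>z\<close> singles out the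
  generator whose normal closure is studied.\<close>

locale repetition_free_group = group G for G (structure) +
  fixes g :: "nat \<Rightarrow> 'a" and z :: nat
  assumes g_closed [simp]: "g i \<in> carrier G"
    and generated: "carrier G = generate G (range g)"
    and repetition: "\<not> distinct is \<Longrightarrow> ln_commutator G (map g is) = \<one>"
begin

definition lnc :: "nat list \<Rightarrow> 'a" where
  "lnc is = ln_commutator G (map g is)"

lemma lnc_closed [simp]: "lnc is \<in> carrier G"
  unfolding lnc_def by (rule ln_commutator_closed) auto

lemma lnc_single [simp]: "lnc [i] = g i"
  by (simp add: lnc_def)

lemma lnc_snoc: "is \<noteq> [] \<Longrightarrow> lnc (is @ [j]) = commutator G (lnc is) (g j)"
  by (cases "is") (auto simp: lnc_def)

lemma lnc_repetition: "\<not> distinct is \<Longrightarrow> lnc is = \<one>"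
  by (simp add: lnc_def repetition)

text \<open>Conjugating \<open>a = lnc w\<close> by \<open>g j\<close> multiplies it by \<open>d = lnc (w @ [j])\<close>. A further commutator with \<open>g j\<close>
  repeats the letter \<open>j\<close>, so \<open>d\<close> commutes with \<open>g j\<close> and conjugation by the inverse of \<open>g j\<close>
  multiplies \<open>a\<close> by the inverse of \<open>d\<close>.\<close>

lemma normal_generate_lnc:
  assumes S: "\<And>is j. is \<in> S \<Longrightarrow> is \<noteq> [] \<and> is @ [j] \<in> S"
  shows "generate G (lnc ` S) \<lhd> G"
proof (rule normal_if_generators_conjugate[OF generated])
  let ?H = "generate G (lnc ` S)"
  show H: "subgroup ?H G" by (rule generate_is_subgroup) auto
  interpret H: subgroup ?H G by fact
  have conj: "inv (g j) \<otimes> a \<otimes> g j \<in> ?H \<and> g j \<otimes> a \<otimes> inv (g j) \<in> ?H"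
    if a: "a \<in> lnc ` S" for a j
  proof -
    obtain w where w: "w \<in> S" "a = lnc w" using a by blast
    define d where "d = lnc (w @ [j])"
    have d: "d = commutator G a (g j)"
      using S[OF w(1), of j] w by (simp add: d_def lnc_snoc)
    have dH: "d \<in> ?H"
      using S[OF w(1), of j] unfolding d_def by (intro generate.incl imageI) simp
    have "commutator G d (g j) = lnc (w @ [j] @ [j])"
      using lnc_snoc[of "w @ [j]" j] by (simp add: d_def)
    then have "commutator G d (g j) = \<one>" by (simp add: lnc_repetition)
    then have dg: "d \<otimes> g j = g j \<otimes> d"
      by (subst (asm) commutator_eq_one_iff) (auto simp: d_def)
    have aG: "a \<in> carrier G" and dG: "d \<in> carrier G" using w by (auto simp: d_def)
    have "a \<in> ?H" using a by (rule generate.incl)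
    moreover have "inv (g j) \<otimes> a \<otimes> g j = a \<otimes> d"
      using aG by (simp add: d group_word_simps)
    moreover have "g j \<otimes> a \<otimes> inv (g j) = a \<otimes> inv d"
    proof -
      have "a \<otimes> g j = g j \<otimes> a \<otimes> d" using aG by (simp add: d group_word_simps)
      then have "a \<otimes> g j \<otimes> inv d \<otimes> inv (g j) = g j \<otimes> a \<otimes> inv (g j)"
        using aG dG by (simp add: group_word_simps)
      moreover have "g j \<otimes> inv d = inv d \<otimes> g j"
        using dg dG inv_solve_right[of "inv d \<otimes> g j" "g j" d] inv_solve_left[of "g j" d "g j \<otimes> d"]
        by (simp add: m_assoc)
      ultimately show ?thesis using aG dG by (simp add: group_word_simps)
    qed
    ultimately show ?thesis using dH by auto
  qed
  show "inv x \<otimes> h \<otimes> x \<in> ?H \<and> x \<otimes> h \<otimes> inv x \<in> ?H" if h: "h \<in> ?H" and xg: "x \<in> range g" for h x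
  proof -
    obtain j where x: "x = g j" using xg by blast
    show ?thesis using h
    proof induction
      case (incl a) then show ?case using conj x by blast
    next
      case (inv a)
      then obtain w where w: "a = lnc w" by blast
      have "inv x \<otimes> inv a \<otimes> x = inv (inv x \<otimes> a \<otimes> x)" "x \<otimes> inv a \<otimes> inv x = inv (x \<otimes> a \<otimes> inv x)"
        by (simp_all add: w x group_word_simps)
      then show ?case using conj[OF inv, of j] x by simp
    next
      case (eng a b)
      then have "a \<in> carrier G" "b \<in> carrier G" by auto
      then have "inv x \<otimes> (a \<otimes> b) \<otimes> x = (inv x \<otimes> a \<otimes> x) \<otimes> (inv x \<otimes> b \<otimes> x)"
        "x \<otimes> (a \<otimes> b) \<otimes> inv x = (x \<otimes> a \<otimes> inv x) \<otimes> (x \<otimes> b \<otimes> inv x)"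
        by (simp_all add: x group_word_simps)
      then show ?case using eng by simp
    qed (simp add: x)
  qed
qed auto

text \<open>The normal closure of \<open>g i\<close>, given by generators: only commutators that start with \<open>i\<close> are used.\<close>

definition letter_subgroup :: "nat \<Rightarrow> 'a set" where
  "letter_subgroup i = generate G (lnc ` range ((#) i))"

lemma normal_letter_subgroup: "letter_subgroup i \<lhd> G"
  unfolding letter_subgroup_def by (rule normal_generate_lnc) auto

lemma letter_subgroup_closed: "a \<in> letter_subgroup i \<Longrightarrow> a \<in> carrier G"
  using normal_imp_subgroup[OF normal_letter_subgroup] subgroup.mem_carrier by metis

lemma lnc_in_letter_subgroup: "i \<in> set is \<Longrightarrow> lnc is \<in> letter_subgroup i"
proof (induction "is" rule: rev_induct)
  case (snoc j "is")
  have g: "g i \<in> letter_subgroup i"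
    using generate.incl[OF imageI[OF rangeI[of "(#) i" "[]"]], of lnc G] by (simp add: letter_subgroup_def)
  show ?case
  proof (cases "is = []")
    case True then show ?thesis using snoc g by simp
  next
    case False
    then show ?thesis
      using snoc g commutator_in_normal[OF normal_letter_subgroup lnc_closed g_closed]
      by (auto simp: lnc_snoc)
  qed
qed simp

text \<open>The generator \<open>g i\<close> centralizes all \<open>lnc (i # w)\<close>, because one more \<open>i\<close> is a repetition. So it lies in
  the centralizer of \<open>letter_subgroup i\<close>. That centralizer is normal, hence contains the
  normal closure of \<open>g i\<close>.\<close>

lemma letter_subgroup_commute:
  assumes "a \<in> letter_subgroup i" "b \<in> letter_subgroup i"
  shows "a \<otimes> b = b \<otimes> a"
proof -
  let ?A = "letter_subgroup i"
  have triv: "{\<one>} \<lhd> G" by (rule one_is_normal)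
  have A: "?A \<subseteq> carrier G" using letter_subgroup_closed by blast
  have "commutator G (g i) (lnc (i # w)) = \<one>" for w
  proof -
    have "commutator G (lnc (i # w)) (g i) = lnc ((i # w) @ [i])" by (simp add: lnc_snoc[symmetric])
    then have "commutator G (lnc (i # w)) (g i) = \<one>" by (simp add: lnc_repetition)
    then show ?thesis by (metis commutator_eq_one_iff g_closed lnc_closed)
  qed
  then have "?A \<subseteq> relative_centralizer {g i} {\<one>}"
    unfolding letter_subgroup_def
    by (intro generate_subgroup_incl subgroup_relative_centralizer[OF triv])
      (auto simp: relative_centralizer_def)
  then have "commutator G t (g i) = \<one>" if "t \<in> ?A" for t
    using A that inv_commutator[of "g i" t] by (auto simp: relative_centralizer_def)
  then have gi: "g i \<in> relative_centralizer ?A {\<one>}"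
    by (simp add: relative_centralizer_def)
  have N: "relative_centralizer ?A {\<one>} \<lhd> G"
    by (intro normal_relative_centralizer triv normal_letter_subgroup)
  have "lnc (i # w) \<in> relative_centralizer ?A {\<one>}" for w
  proof (induction w rule: rev_induct)
    case (snoc j w)
    then show ?case
      using lnc_snoc[of "i # w" j] commutator_in_normal(1)[OF N lnc_closed g_closed] by simp
  qed (use gi in simp)
  then have "?A \<subseteq> relative_centralizer ?A {\<one>}"
    unfolding letter_subgroup_def[of i]
    by (intro generate_subgroup_incl[OF _ normal_imp_subgroup[OF N[unfolded letter_subgroup_def]]])
      (auto simp: letter_subgroup_def)
  then have "commutator G a b = \<one>"
    using assms by (auto simp: relative_centralizer_def)
  then show ?thesis
    using assms A by (subst (asm) commutator_eq_one_iff) auto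
qed

lemma comm_group_letter_subgroup: "comm_group (G\<lparr>carrier := letter_subgroup i\<rparr>)"
  by (rule group.group_comm_groupI)
    (auto simp: letter_subgroup_commute intro!: subgroup_imp_group normal_imp_subgroup normal_letter_subgroup)

text \<open>The additive map that sends the word \<open>w\<close> to \<open>lnc (z # w)\<close>; it exists because \<open>letter_subgroup z\<close> is
  abelian.\<close>

definition ev :: "word_module \<Rightarrow> 'a" where
  "ev = (SOME h. h \<in> hom (free_Abelian_group UNIV) (G\<lparr>carrier := letter_subgroup z\<rparr>)
          \<and> (\<forall>w. h (frag_of w) = lnc (z # w)))"

lemma ev_hom: "ev \<in> hom (free_Abelian_group UNIV) (G\<lparr>carrier := letter_subgroup z\<rparr>)"
  and ev_frag_of: "ev (frag_of w) = lnc (z # w)"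
proof -
  interpret A: comm_group "G\<lparr>carrier := letter_subgroup z\<rparr>" by (rule comm_group_letter_subgroup)
  have "range (\<lambda>w. lnc (z # w)) \<subseteq> carrier (G\<lparr>carrier := letter_subgroup z\<rparr>)"
    by (auto simp: lnc_in_letter_subgroup)
  from A.free_Abelian_group_universal[OF this]
  have "\<exists>h. h \<in> hom (free_Abelian_group UNIV) (G\<lparr>carrier := letter_subgroup z\<rparr>)
          \<and> (\<forall>w. h (frag_of w) = lnc (z # w))"
    by (metis UNIV_I)
  from someI_ex[OF this]
  show "ev \<in> hom (free_Abelian_group UNIV) (G\<lparr>carrier := letter_subgroup z\<rparr>)"
    "ev (frag_of w) = lnc (z # w)" by (auto simp: ev_def)
qed

lemma ev_in_letter_subgroup: "ev m \<in> letter_subgroup z"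
  using hom_in_carrier[OF ev_hom, of m] by simp

lemma ev_closed [simp]: "ev m \<in> carrier G"
  using ev_in_letter_subgroup letter_subgroup_closed by blast

lemma ev_add: "ev (m + m') = ev m \<otimes> ev m'"
  using hom_mult[OF ev_hom, of m m'] by simp

lemma ev_zero [simp]: "ev 0 = \<one>"
  using ev_add[of 0 0] l_cancel_one'[of "ev 0" "ev 0"] by simp

lemma ev_minus: "ev (- m) = inv (ev m)"
  using ev_add[of "- m" m] by (simp add: inv_equality)

lemma ev_diff: "ev (m - m') = ev m \<otimes> inv (ev m')"
  using ev_add[of m "- m'"] by (simp add: ev_minus)

lemma ev_cmul: "ev (frag_cmul (int k) m) = ev m [^] k"
proof (induction k)
  case (Suc k)
  have "frag_cmul (int (Suc k)) m = frag_cmul (int k) m + m"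
    by (simp add: frag_cmul_distrib)
  with Suc show ?case by (simp add: ev_add)
qed simp

lemma ev_add_span:
  assumes "m \<in> add_span S" "subgroup H G" "\<And>s. s \<in> S \<Longrightarrow> ev s \<in> H"
  shows "ev m \<in> H"
  using assms(1)
proof induction
  case zero
  then show ?case using assms(2) by (simp add: subgroup.one_closed)
next
  case (diff a b)
  then show ?case using assms(2) by (simp add: ev_diff subgroup.m_closed subgroup.m_inv_closed)
qed (use assms in auto)

text \<open>The operator \<open>f\<close> is a lift of \<open>k - 1\<close> to the free module.\<close>

definition acts_as :: "'a \<Rightarrow> (word_module \<Rightarrow> word_module) \<Rightarrow> bool" where
  "acts_as k f \<longleftrightarrow> (\<forall>m. commutator G (ev m) k = ev (f m))"

lemma acts_as_conj:
  assumes "k \<in> carrier G"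
  shows "acts_as k f \<longleftrightarrow> (\<forall>m. inv k \<otimes> ev m \<otimes> k = ev (m + f m))"
  using assms by (simp add: acts_as_def ev_add conjugate_eq_mult_commutator commutator_closed)

text \<open>Taking commutators with \<open>x\<close> is a homomorphism on an abelian normal subgroup.\<close>

lemma commutator_ev_diff:
  assumes x: "x \<in> carrier G"
  shows "commutator G (ev (m - m')) x = commutator G (ev m) x \<otimes> inv (commutator G (ev m') x)"
proof -
  let ?a = "ev m" and ?b = "ev m'"
  define c where "c = inv ?a \<otimes> (inv x \<otimes> ev (m - m') \<otimes> x)"
  interpret A: normal "letter_subgroup z" G by (rule normal_letter_subgroup)
  have cA: "c \<in> letter_subgroup z"
    unfolding c_def using x by (intro A.m_closed A.m_inv_closed A.inv_op_closed1 ev_in_letter_subgroup)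
  have "commutator G (ev (m - m')) x = ?b \<otimes> c"
    using x by (simp add: c_def ev_diff group_word_simps)
  also have "\<dots> = c \<otimes> ?b"
    using cA ev_in_letter_subgroup letter_subgroup_commute by blast
  also have "\<dots> = commutator G (ev m) x \<otimes> inv (commutator G (ev m') x)"
    using x by (simp add: c_def ev_diff group_word_simps)
  finally show ?thesis .
qed

lemma acts_as_generator: "acts_as (g i) (append_letter i)"
  unfolding acts_as_def
proof
  fix m :: word_module
  have "Poly_Mapping.keys m \<subseteq> UNIV" by simp
  then show "commutator G (ev m) (g i) = ev (append_letter i m)"
  proof (induction m rule: frag_induction)
    case zero
    then show ?case by (simp add: additive.zero[OF additive_append_letter] commutator_def)
  next
    case (one w)
    then show ?case using lnc_snoc[of "z # w" i] by (simp add: ev_frag_of)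
  next
    case (diff a b)
    then show ?case
      using commutator_ev_diff[OF g_closed, of a b i]
      by (simp add: additive.diff[OF additive_append_letter] ev_diff)
  qed
qed

definition null :: "word_module set" where
  "null = {m. ev m = \<one>}"

lemma null_zero: "0 \<in> null" by (simp add: null_def)
lemma null_diff: "a \<in> null \<Longrightarrow> b \<in> null \<Longrightarrow> a - b \<in> null" by (simp add: null_def ev_diff)
lemma null_add: "a \<in> null \<Longrightarrow> b \<in> null \<Longrightarrow> a + b \<in> null" by (simp add: null_def ev_add)
lemma null_minus: "a \<in> null \<Longrightarrow> - a \<in> null" by (simp add: null_def ev_minus)
lemma null_cmul: "a \<in> null \<Longrightarrow> frag_cmul c a \<in> null"
  by (rule frag_closure_minus_cmul) (auto intro: null_zero null_diff)

lemma ev_eqI: "a - b \<in> null \<Longrightarrow> ev a = ev b"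
proof -
  assume "a - b \<in> null"
  then have "ev ((a - b) + b) = ev b" unfolding ev_add by (simp add: null_def)
  then show ?thesis by simp
qed

lemma null_acts:
  assumes "acts_as k f" "k \<in> carrier G" "m \<in> null"
  shows "f m \<in> null"
  using assms by (simp add: null_def acts_as_def[THEN iffD1, rule_format, symmetric] commutator_def)

text \<open>For \<open>c\<close> in the normal closure of a generator, \<open>[a, c]\<close> and all its further commutators
  stay in that normal closure, which is abelian, so that one more commutator with \<open>c\<close> is trivial. In
  operators: \<open>f f = 0\<close> and \<open>f h f = 0\<close> on the normal closure of \<open>g z\<close>.\<close>

lemma null_acts_twice:
  assumes c: "c \<in> letter_subgroup i" "acts_as c f"
  shows "f (f m) \<in> null"
    and "\<lbrakk>d \<in> carrier G; acts_as d h\<rbrakk> \<Longrightarrow> f (h (f m)) \<in> null"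
proof -
  have cG: "c \<in> carrier G" using c letter_subgroup_closed by blast
  have 1: "ev (f m) \<in> letter_subgroup i"
    using commutator_in_normal(2)[OF normal_letter_subgroup ev_closed cG c(1)] c(2)
    by (simp add: acts_as_def)
  have 2: "f m' \<in> null" if "ev m' \<in> letter_subgroup i" for m'
    using letter_subgroup_commute[OF that c(1)] c(2) commutator_eq_one_iff[OF ev_closed cG]
    by (simp add: null_def acts_as_def)
  show "f (f m) \<in> null" using 1 2 by blast
  show "f (h (f m)) \<in> null" if "d \<in> carrier G" "acts_as d h"
    using 1 2 commutator_in_normal(1)[OF normal_letter_subgroup ev_closed that(1), of "f m" i] that(2)
    by (simp add: acts_as_def)
qed

lemma acts_as_inv:
  assumes c: "c \<in> letter_subgroup i" "acts_as c f" and f: "additive f"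
  shows "acts_as (inv c) (\<lambda>m. - f m)"
proof -
  have cG: "c \<in> carrier G" using c letter_subgroup_closed by blast
  have "inv (inv c) \<otimes> ev m \<otimes> inv c = ev (m + - f m)" for m
  proof -
    have "inv c \<otimes> ev (m - f m) \<otimes> c = ev ((m - f m) + f (m - f m))"
      using c cG by (simp add: acts_as_conj)
    also have "\<dots> = ev m"
      using null_minus[OF null_acts_twice(1)[OF c]] by (intro ev_eqI) (simp add: additive.diff[OF f])
    finally have "c \<otimes> (inv c \<otimes> ev (m - f m) \<otimes> c) \<otimes> inv c = c \<otimes> ev m \<otimes> inv c" by simp
    then show ?thesis using cG by (simp add: group_word_simps)
  qed
  then show ?thesis using cG by (subst acts_as_conj) auto
qed

lemma acts_as_mult:
  assumes "k \<in> carrier G" "l \<in> carrier G" "acts_as k f" "acts_as l h"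
  shows "acts_as (k \<otimes> l) (\<lambda>m. f m + h (m + f m))"
proof -
  have "inv (k \<otimes> l) \<otimes> ev m \<otimes> (k \<otimes> l) = ev (m + (f m + h (m + f m)))" for m
  proof -
    have "inv (k \<otimes> l) \<otimes> ev m \<otimes> (k \<otimes> l) = inv l \<otimes> (inv k \<otimes> ev m \<otimes> k) \<otimes> l"
      using assms by (simp add: group_word_simps)
    also have "\<dots> = ev ((m + f m) + h (m + f m))"
      using assms by (simp only: acts_as_conj[THEN iffD1, rule_format])
    finally show ?thesis by (simp add: add_ac)
  qed
  then show ?thesis using assms by (subst acts_as_conj) auto
qed

lemma acts_as_cong: "acts_as k f \<Longrightarrow> (\<And>m. f m - h m \<in> null) \<Longrightarrow> acts_as k h"
  using ev_eqI by (metis acts_as_def)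

text \<open>With \<open>f f = 0\<close> and \<open>h h = 0\<close> the commutator acts as
  \<open>(1 - f) (1 - h) (1 + f) (1 + h)\<close>. In the expansion the linear terms cancel, and all other terms
  except \<open>1\<close> and \<open>f h - h f\<close> vanish or cancel, since \<open>f f\<close>, \<open>h h\<close>, \<open>f h f\<close> and \<open>h f h\<close> are zero.\<close>

lemma acts_as_commutator:
  assumes c: "c \<in> letter_subgroup i" "acts_as c f" "additive f"
    and d: "d \<in> letter_subgroup j" "acts_as d h" "additive h"
  shows "acts_as (commutator G c d) (bracket f h)"
proof -
  have G: "c \<in> carrier G" "d \<in> carrier G" using c d letter_subgroup_closed by blast+
  note act = acts_as_mult[OF _ _ acts_as_mult[OF _ _ acts_as_mult[OF _ _
        acts_as_inv[OF c] acts_as_inv[OF d]] c(2)] d(2)]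
  interpret f: additive f by fact
  interpret h: additive h by fact
  show ?thesis
    unfolding commutator_def
  proof (rule acts_as_cong[OF act])
    fix m
    have "f (f m) \<in> null" "h (h m) \<in> null" "f (h (f m)) \<in> null" "h (f (h m)) \<in> null"
      "h (h (f m)) \<in> null" "h (f (h (f m))) \<in> null" "h (f (f m)) \<in> null"
      using null_acts_twice[OF c(1,2)] null_acts_twice[OF d(1,2)] null_acts[OF d(2) G(2)] c d G by auto
    then have "(f (h (f m)) - f (f m)) - h (h m) + h (h (f m)) - h (f (h m))
         + h (f (h (f m))) - h (f (f m)) \<in> null"
      by (intro null_diff null_add)
    moreover have "(- f m + - h (m + - f m) + f (m + (- f m + - h (m + - f m))) +
          h (m + (- f m + - h (m + - f m) + f (m + (- f m + - h (m + - f m)))))) - bracket f h m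
      = (f (h (f m)) - f (f m)) - h (h m) + h (h (f m)) - h (f (h m))
         + h (f (h (f m))) - h (f (f m))"
      by (simp add: bracket_def f.add f.minus f.diff h.add h.minus h.diff algebra_simps)
    ultimately show "(- f m + - h (m + - f m) + f (m + (- f m + - h (m + - f m))) +
          h (m + (- f m + - h (m + - f m) + f (m + (- f m + - h (m + - f m)))))) - bracket f h m \<in> null"
      by simp
  qed (use G in auto)
qed

lemma acts_as_lnc: "is \<noteq> [] \<Longrightarrow> acts_as (lnc is) (ln_bracket is)"
proof (induction "is" rule: rev_nonempty_induct)
  case (single i)
  then show ?case by (simp add: acts_as_generator del: ln_bracket.simps)
next
  case (snoc i "is")
  have "g i \<in> letter_subgroup i" using lnc_in_letter_subgroup[of i "[i]"] by simp
  then show ?case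
    using acts_as_commutator[OF lnc_in_letter_subgroup snoc.IH additive_ln_bracket _
        acts_as_generator additive_append_letter, of "hd is"] snoc.hyps
    by (simp add: lnc_snoc ln_bracket_snoc)
qed

lemma acts_as_pow:
  assumes c: "c \<in> letter_subgroup i" "acts_as c f" and f: "additive f"
  shows "acts_as (c [^] k) (\<lambda>m. frag_cmul (int k) (f m))"
proof (induction k)
  case 0
  then show ?case by (simp add: acts_as_def commutator_def)
next
  case (Suc k)
  have cG: "c \<in> carrier G" using c letter_subgroup_closed by blast
  have "acts_as (c [^] k \<otimes> c) (\<lambda>m. frag_cmul (int (Suc k)) (f m))"
  proof (rule acts_as_cong[OF acts_as_mult[OF _ _ Suc c(2)]])
    fix m
    show "frag_cmul (int k) (f m) + f (m + frag_cmul (int k) (f m)) - frag_cmul (int (Suc k)) (f m) \<in> null"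
      using null_cmul[OF null_acts_twice(1)[OF c]]
      by (simp add: additive.add[OF f] additive_cmul[OF f] frag_cmul_distrib)
  qed (use cG in auto)
  then show ?case by simp
qed

lemma acts_as_pow_general:
  assumes k: "k \<in> carrier G" and f: "acts_as k f"
  shows "acts_as (k [^] (e::nat)) (\<lambda>m. ((\<lambda>m. m + f m) ^^ e) m - m)"
proof (induction e)
  case 0
  then show ?case by (simp add: acts_as_def commutator_def)
next
  case (Suc e)
  show ?case
    using acts_as_mult[OF _ k Suc f] k by (simp add: acts_as_def algebra_simps)
qed

text \<open>The commutator with a letter is additive, so the exponent \<open>q\<close> of \<open>g z\<close> is inherited by all
  \<open>lnc (z # w)\<close>.\<close>

lemma null_exponent:
  assumes "\<And>i. g i [^] (q::nat) = \<one>"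
  shows "frag_cmul (int q) m \<in> null"
proof -
  have "frag_cmul (int q) (frag_of w) \<in> null" for w
  proof (induction w rule: rev_induct)
    case Nil
    then show ?case using assms by (simp add: null_def ev_cmul ev_frag_of)
  next
    case (snoc i w)
    from null_acts[OF acts_as_generator g_closed this, of i]
    show ?case by (simp add: additive_cmul[OF additive_append_letter])
  qed
  then show ?thesis
    using frag_induction[of m UNIV "\<lambda>m. frag_cmul (int q) m \<in> null"]
    by (simp add: null_zero null_diff additive.diff[OF additive_frag_cmul])
qed

end

context repetition_free_group begin

text \<open>The subgroup on the right is normal, and modulo it the generators commute. In general the derived
  subgroup is only the normal closure of the commutators of generators.\<close>

lemma derived_eq_generate_lnc: "derived G (carrier G) = generate G (lnc ` {is. length is \<ge> 2})"
proof
  let ?H = "generate G (lnc ` {is. length is \<ge> 2})"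
  have N: "?H \<lhd> G" by (rule normal_generate_lnc) auto
  show "derived G (carrier G) \<subseteq> ?H"
    unfolding generated
  proof (rule derived_generate_subset[OF N])
    fix a b assume "a \<in> range g" "b \<in> range g"
    then obtain i j where "a = g i" "b = g j" by blast
    then have "commutator G a b = lnc [i, j]" by (simp add: lnc_def)
    then show "commutator G a b \<in> ?H" by (auto intro!: generate.incl)
  qed auto
  have "lnc is \<in> derived G (carrier G)" if "length is \<ge> 2" for "is"
  proof (cases "is" rule: rev_cases)
    case (snoc js j)
    then have "js \<noteq> []" using that by auto
    then have "lnc is = commutator G (lnc js) (g j)" using snoc lnc_snoc[of js j] by simp
    then show ?thesis
      unfolding derived_eq_commutator_subgroup[OF subgroup_self] commutator_subgroup_def
      using lnc_closed[of js] g_closed[of j] by (intro generate.incl) blast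
  qed (use that in simp)
  then show "?H \<subseteq> derived G (carrier G)"
    by (intro generate_subgroup_incl derived_is_subgroup) auto
qed

definition gprod :: "nat list \<Rightarrow> 'a" where
  "gprod is = foldr (\<lambda>i h. g i \<otimes> h) is \<one>"

lemma gprod_simps [simp]: "gprod [] = \<one>" "gprod (i # is) = g i \<otimes> gprod is"
  by (simp_all add: gprod_def)

lemma gprod_closed [simp]: "gprod is \<in> carrier G"
  by (induction "is") auto

lemma gprod_snoc: "gprod (is @ [j]) = gprod is \<otimes> g j"
  by (induction "is") (auto simp: m_assoc)

text \<open>The expansion of \<open>(1 + X\<^sub>i) \<cdots> (1 + X\<^sub>j) - 1\<close>, where \<open>X\<^sub>i\<close> is \<open>append_letter i\<close>.\<close>

fun prod_operator :: "nat list \<Rightarrow> word_module \<Rightarrow> word_module" where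
  "prod_operator [] m = 0"
| "prod_operator (i # is) m = append_letter i m + prod_operator is (m + append_letter i m)"

lemma additive_prod_operator: "additive (prod_operator is)"
proof
  show "prod_operator is (a + b) = prod_operator is a + prod_operator is b" for a b
  proof (induction "is" arbitrary: a b)
    case (Cons i "is")
    have "(a + b) + append_letter i (a + b) = (a + append_letter i a) + (b + append_letter i b)"
      by (simp add: additive.add[OF additive_append_letter])
    then show ?case
      using Cons by (simp add: additive.add[OF additive_append_letter])
  qed simp
qed

lemma acts_as_gprod: "acts_as (gprod is) (prod_operator is)"
proof (induction "is")
  case Nil
  then show ?case by (simp add: acts_as_def commutator_def)
next
  case (Cons i "is")
  have "prod_operator (i # is) = (\<lambda>m. append_letter i m + prod_operator is (m + append_letter i m))"
    by (simp add: fun_eq_iff)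
  then show ?case using acts_as_mult[OF _ _ acts_as_generator Cons] by simp
qed

lemma gprod_pow_in_normal:
  assumes P: "P \<lhd> G" and "derived G (carrier G) \<subseteq> P" and "\<And>i. g i [^] (p::nat) \<in> P"
  shows "gprod is [^] p \<in> P"
proof (induction "is")
  case Nil
  then show ?case using P by (simp add: normal_imp_subgroup subgroup.one_closed)
next
  case (Cons i "is")
  have "commutator G (g i) (gprod is) \<in> P"
    using assms(2) g_closed gprod_closed
    unfolding derived_eq_commutator_subgroup[OF subgroup_self] commutator_subgroup_def
    by (blast intro: generate.incl)
  then show ?case using pow_mult_in_normal[OF P] assms Cons by simp
qed

section \<open>Filtration of the normal closure of a generator\<close>

text \<open>Since the kernel of \<open>ev\<close> is included, these sets correspond to the subgroups of \<open>letter_subgroup z\<close> that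
  are normal in \<open>G\<close>.\<close>

definition submodule :: "word_module set \<Rightarrow> bool" where
  "submodule S \<longleftrightarrow> null \<subseteq> S \<and> (\<forall>a\<in>S. \<forall>b\<in>S. a - b \<in> S) \<and> (\<forall>m\<in>S. \<forall>i. append_letter i m \<in> S)"

lemma submodule_span:
  assumes "null \<subseteq> T" "\<And>i t. t \<in> T \<Longrightarrow> append_letter i t \<in> add_span T"
  shows "submodule (add_span T)"
  using assms add_span_image[OF _ additive_append_letter]
  by (auto simp: submodule_def intro: add_span.intros)

context
  fixes S assumes S: "submodule S"
begin

lemma submodule_null: "m \<in> null \<Longrightarrow> m \<in> S"
  using S by (auto simp: submodule_def)

lemma submodule_zero: "0 \<in> S"
  by (rule submodule_null) (rule null_zero)

lemma submodule_diff: "a \<in> S \<Longrightarrow> b \<in> S \<Longrightarrow> a - b \<in> S"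
  using S by (auto simp: submodule_def)

lemma submodule_minus: "a \<in> S \<Longrightarrow> - a \<in> S"
  using submodule_diff[OF submodule_zero] by fastforce

lemma submodule_add: "a \<in> S \<Longrightarrow> b \<in> S \<Longrightarrow> a + b \<in> S"
  using submodule_diff[of a "- b"] submodule_minus by fastforce

lemma submodule_cmul: "a \<in> S \<Longrightarrow> frag_cmul c a \<in> S"
  by (rule frag_closure_minus_cmul) (auto intro: submodule_zero submodule_diff)

lemma submodule_sum: "(\<And>i. i \<in> I \<Longrightarrow> f i \<in> S) \<Longrightarrow> sum f I \<in> S"
  by (induction I rule: infinite_finite_induct) (auto intro: submodule_zero submodule_add)

lemma submodule_append_letter: "m \<in> S \<Longrightarrow> append_letter i m \<in> S"
  using S by (auto simp: submodule_def)

lemma submodule_bracket: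
  assumes "\<And>m. m \<in> S \<Longrightarrow> f m \<in> S" "\<And>m. m \<in> S \<Longrightarrow> h m \<in> S" "m \<in> S"
  shows "bracket f h m \<in> S"
  using assms by (simp add: bracket_def submodule_diff)

lemma submodule_ln_bracket: "m \<in> S \<Longrightarrow> ln_bracket is m \<in> S"
proof (induction "is" arbitrary: m rule: rev_induct)
  case Nil
  then show ?case by (simp add: submodule_zero)
next
  case (snoc i "is")
  show ?case
  proof (cases "is = []")
    case True
    with snoc.prems show ?thesis by (simp add: submodule_append_letter)
  next
    case False
    with snoc show ?thesis
      by (simp add: ln_bracket_snoc submodule_bracket submodule_append_letter)
  qed
qed

lemma submodule_prod_operator: "m \<in> S \<Longrightarrow> prod_operator is m \<in> S"
  by (induction "is" arbitrary: m) (auto intro: submodule_zero submodule_add submodule_append_letter)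

lemma submodule_funpow: "(\<And>m. m \<in> S \<Longrightarrow> f m \<in> S) \<Longrightarrow> m \<in> S \<Longrightarrow> (f ^^ k) m \<in> S"
  by (induction k) auto

lemma ev_in_image_submodule: "ev m \<in> ev ` S \<longleftrightarrow> m \<in> S"
proof
  assume "ev m \<in> ev ` S"
  then obtain s where s: "s \<in> S" "ev m = ev s" by blast
  then have "m - s \<in> S" by (intro submodule_null) (simp add: null_def ev_diff)
  then show "m \<in> S" using submodule_add[OF _ s(1)] by fastforce
qed simp

text \<open>Conjugation by \<open>g i\<close> is \<open>1 + X\<^sub>i\<close>, and by its inverse it is \<open>1 - X\<^sub>i\<close>; both preserve the submodule.\<close>

lemma normal_image_submodule: "ev ` S \<lhd> G"
proof (rule normal_if_generators_conjugate[OF generated])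
  show "subgroup (ev ` S) G"
  proof (rule subgroupI)
    show "ev ` S \<noteq> {}" using submodule_zero by blast
    show "inv a \<in> ev ` S" if "a \<in> ev ` S" for a
      using that submodule_minus by (auto simp: ev_minus[symmetric])
    show "a \<otimes> b \<in> ev ` S" if "a \<in> ev ` S" "b \<in> ev ` S" for a b
      using that submodule_add by (auto simp: ev_add[symmetric])
  qed auto
  fix h x assume "h \<in> ev ` S" "x \<in> range g"
  then obtain s i where s: "h = ev s" "s \<in> S" and x: "x = g i" by blast
  have gi: "g i \<in> letter_subgroup i" using lnc_in_letter_subgroup[of i "[i]"] by simp
  have "inv x \<otimes> h \<otimes> x = ev (s + append_letter i s)"
    using acts_as_generator[of i] by (simp add: x s acts_as_conj)
  moreover have "x \<otimes> h \<otimes> inv x = ev (s - append_letter i s)"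
    using acts_as_inv[OF gi acts_as_generator additive_append_letter]
    by (simp add: x s acts_as_conj)
  ultimately show "inv x \<otimes> h \<otimes> x \<in> ev ` S \<and> x \<otimes> h \<otimes> inv x \<in> ev ` S"
    using s submodule_add submodule_diff submodule_append_letter by simp
qed auto

end

lemma in_relative_centralizer_image:
  assumes "submodule S" "k \<in> carrier G" "acts_as k f"
  shows "k \<in> relative_centralizer (ev ` T) (ev ` S) \<longleftrightarrow> (\<forall>m\<in>T. f m \<in> S)"
  using assms ev_in_image_submodule[OF assms(1)]
  by (auto simp: relative_centralizer_def acts_as_def)

lemma append_letter_null: "m \<in> null \<Longrightarrow> append_letter i m \<in> null"
  using null_acts[OF acts_as_generator g_closed] .

lemma ln_bracket_null: "m \<in> null \<Longrightarrow> ln_bracket is m \<in> null"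
  using null_acts[OF acts_as_lnc lnc_closed, of "is"] null_zero by (cases "is = []") auto

text \<open>The module \<open>V\<close> of the introduction: the empty word, which stands for \<open>g z\<close> itself, is left out.\<close>

definition proper_words :: "word_module set" where
  "proper_words = add_span ({frag_of w | w. w \<noteq> []} \<union> null)"

lemma submodule_proper_words: "submodule proper_words"
  unfolding proper_words_def
  by (rule submodule_span) (auto intro!: add_span.base append_letter_null)

lemma append_letter_in_proper_words: "append_letter i m \<in> proper_words"
proof -
  have "Poly_Mapping.keys m \<subseteq> UNIV" by simp
  then show ?thesis
  proof (induction m rule: frag_induction)
    case (one w)
    then show ?case by (auto simp: proper_words_def intro: add_span.base)
  qed (simp_all add: additive.zero[OF additive_append_letter] additive.diff[OF additive_append_letter]
      submodule_zero[OF submodule_proper_words] submodule_diff[OF submodule_proper_words])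
qed

lemma prod_operator_in_proper_words: "prod_operator is m \<in> proper_words"
  by (induction "is" arbitrary: m)
    (auto intro: submodule_zero[OF submodule_proper_words] submodule_add[OF submodule_proper_words]
      append_letter_in_proper_words)

text \<open>The module \<open>U = [V, \<gamma>\<^sub>2]\<close>, with homogeneous generators.\<close>

definition bracketed :: "word_module set" where
  "bracketed = add_span ({ln_bracket is (frag_of w) | is w. length is \<ge> 2 \<and> w \<noteq> []} \<union> null)"

lemma append_letter_ln_bracket:
  "is \<noteq> [] \<Longrightarrow> append_letter i (ln_bracket is m) = ln_bracket (is @ [i]) m + ln_bracket is (append_letter i m)"
  by (simp add: ln_bracket_snoc bracket_def)

lemma submodule_bracketed: "submodule bracketed"
  unfolding bracketed_def
proof (rule submodule_span)
  let ?T = "{ln_bracket is (frag_of w) | is w. length is \<ge> 2 \<and> w \<noteq> []} \<union> null"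
  fix i t assume "t \<in> ?T"
  then consider "t \<in> null" | "is" w where "t = ln_bracket is (frag_of w)" "length is \<ge> 2" "w \<noteq> []"
    by blast
  then show "append_letter i t \<in> add_span ?T"
  proof cases
    case 1
    then show ?thesis by (auto intro: add_span.base append_letter_null)
  next
    case 2
    have eq: "append_letter i t = ln_bracket (is @ [i]) (frag_of w) + ln_bracket is (frag_of (w @ [i]))"
      using 2 append_letter_ln_bracket[of "is" i "frag_of w"] by force
    have 1: "ln_bracket (is @ [i]) (frag_of w) \<in> ?T"
      by (rule UnI1, rule CollectI, rule exI[of _ "is @ [i]"], rule exI[of _ w]) (use 2 in simp)
    have 2: "ln_bracket is (frag_of (w @ [i])) \<in> ?T"
      by (rule UnI1, rule CollectI, rule exI[of _ "is"], rule exI[of _ "w @ [i]"]) (use 2 in simp)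
    show ?thesis
      unfolding eq by (rule add_span_add[OF add_span.base[OF 1] add_span.base[OF 2]])
  qed
qed simp

lemma ln_bracket_proper_words_in_bracketed:
  assumes "length is \<ge> 2" "m \<in> proper_words"
  shows "ln_bracket is m \<in> bracketed"
  using assms(2) unfolding proper_words_def bracketed_def
  by (rule add_span_image[OF _ additive_ln_bracket])
    (use assms(1) ln_bracket_null in \<open>auto intro!: add_span.base\<close>)

text \<open>Homogeneous operators of elements that generate the second derived subgroup as a normal
  subgroup, closed under further commutators with letters; the first argument is the degree.\<close>

inductive deep_operator :: "nat \<Rightarrow> (word_module \<Rightarrow> word_module) \<Rightarrow> bool" where
  base: "length is \<ge> 2 \<Longrightarrow> length js \<ge> 2 \<Longrightarrow>
          deep_operator (length is + length js) (bracket (ln_bracket is) (ln_bracket js))"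
| step: "deep_operator d f \<Longrightarrow> deep_operator (Suc d) (bracket f (append_letter i))"

lemma additive_deep_operator: "deep_operator d f \<Longrightarrow> additive f"
  by (induction rule: deep_operator.induct)
    (auto intro: additive_bracket additive_ln_bracket additive_append_letter)

lemma deep_operator_words:
  "deep_operator d f \<Longrightarrow> m \<in> add_span (words_of_length k) \<Longrightarrow> f m \<in> add_span (words_of_length (k + d))"
proof (induction arbitrary: m k rule: deep_operator.induct)
  case (base "is" js)
  show ?case by (rule bracket_words) (use base ln_bracket_words in auto)
next
  case (step d f i)
  have "bracket f (append_letter i) m \<in> add_span (words_of_length (k + (d + 1)))"
    by (rule bracket_words) (use step append_letter_words in auto)
  then show ?case by simp
qed

lemma lie_operator_deep: "deep_operator d f \<Longrightarrow> lie_operator d f \<and> d \<ge> 1"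
  by (induction rule: deep_operator.induct)
    (auto intro!: lie_operator_bracket_ln_bracket lie_operator_bracket_letter)

definition "\<gamma>2 = derived G (carrier G)"
definition "\<gamma>22 = derived G \<gamma>2"

lemma normal_\<gamma>2: "\<gamma>2 \<lhd> G" unfolding \<gamma>2_def by (rule derived_self_is_normal)
lemma normal_\<gamma>22: "\<gamma>22 \<lhd> G" unfolding \<gamma>22_def by (rule derived_is_normal[OF normal_\<gamma>2])

lemma commutator_in_derived:
  assumes "subgroup H G" "a \<in> H" "b \<in> H"
  shows "commutator G a b \<in> derived G H"
  unfolding derived_eq_commutator_subgroup[OF assms(1)] commutator_subgroup_def
  using assms(2,3) by (blast intro: generate.incl)

lemma lnc_in_\<gamma>2: "length is \<ge> 2 \<Longrightarrow> lnc is \<in> \<gamma>2"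
  unfolding \<gamma>2_def derived_eq_generate_lnc by (rule generate.incl) auto

text \<open>Commutators with letters stay in \<open>\<gamma>22\<close> and in a letter subgroup, because both are normal.\<close>

lemma deep_operator_realised:
  "deep_operator d f \<Longrightarrow> \<exists>h\<in>\<gamma>22. \<exists>i. h \<in> letter_subgroup i \<and> acts_as h f"
proof (induction rule: deep_operator.induct)
  case (base "is" js)
  let ?h = "commutator G (lnc is) (lnc js)"
  have "is \<noteq> []" "js \<noteq> []" using base by auto
  then have "?h \<in> letter_subgroup (hd is)" "acts_as ?h (bracket (ln_bracket is) (ln_bracket js))"
    using commutator_in_normal(1)[OF normal_letter_subgroup lnc_closed lnc_closed lnc_in_letter_subgroup]
      acts_as_commutator[OF lnc_in_letter_subgroup acts_as_lnc additive_ln_bracket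
        lnc_in_letter_subgroup acts_as_lnc additive_ln_bracket, of "hd is" "is" "hd js" js] by auto
  moreover have "?h \<in> \<gamma>22"
    unfolding \<gamma>22_def using base
    by (intro commutator_in_derived normal_imp_subgroup[OF normal_\<gamma>2] lnc_in_\<gamma>2)
  ultimately show ?case by blast
next
  case (step d f i)
  then obtain h j where h: "h \<in> \<gamma>22" "h \<in> letter_subgroup j" "acts_as h f" by blast
  have gi: "g i \<in> letter_subgroup i" using lnc_in_letter_subgroup[of i "[i]"] by simp
  have hG: "h \<in> carrier G" using h letter_subgroup_closed by blast
  have "acts_as (commutator G h (g i)) (bracket f (append_letter i))"
    using acts_as_commutator[OF h(2,3) additive_deep_operator[OF step.hyps] gi acts_as_generator
        additive_append_letter] .
  then show ?case
    using commutator_in_normal(1)[OF normal_\<gamma>22 hG g_closed h(1)]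
      commutator_in_normal(1)[OF normal_letter_subgroup hG g_closed h(2)] by blast
qed

text \<open>The module \<open>[U, \<gamma>\<^sub>2\<^sub>2]\<close>, with homogeneous generators.\<close>

definition twice_bracketed :: "word_module set" where
  "twice_bracketed = add_span ({f (ln_bracket is (frag_of w)) | f d is w.
            deep_operator d f \<and> length is \<ge> 2 \<and> w \<noteq> []} \<union> null)"

lemma deep_operator_null: "deep_operator d f \<Longrightarrow> m \<in> null \<Longrightarrow> f m \<in> null"
  using deep_operator_realised letter_subgroup_closed null_acts by metis

lemma deep_operator_bracketed_in_twice_bracketed:
  assumes f: "deep_operator d f" and "m \<in> bracketed"
  shows "f m \<in> twice_bracketed"
  using assms(2) unfolding bracketed_def twice_bracketed_def
  by (rule add_span_image[OF _ additive_deep_operator[OF f]])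
    (use f deep_operator_null in \<open>blast intro: add_span.base\<close>)

lemma submodule_twice_bracketed: "submodule twice_bracketed"
  unfolding twice_bracketed_def
proof (rule submodule_span)
  let ?T = "{f (ln_bracket is (frag_of w)) | f d is w.
            deep_operator d f \<and> length is \<ge> 2 \<and> w \<noteq> []} \<union> null"
  fix i t assume "t \<in> ?T"
  then consider "t \<in> null" | f d "is" w where "t = f (ln_bracket is (frag_of w))"
      "deep_operator d f" "length is \<ge> 2" "w \<noteq> []"
    by blast
  then show "append_letter i t \<in> add_span ?T"
  proof cases
    case 1
    then show ?thesis by (auto intro: add_span.base append_letter_null)
  next
    case 2
    let ?u = "ln_bracket is (frag_of w)"
    have "?u \<in> bracketed" using 2 by (auto simp: bracketed_def intro!: add_span.base)
    then have "append_letter i ?u \<in> bracketed" by (rule submodule_append_letter[OF submodule_bracketed])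
    then have "bracket f (append_letter i) ?u \<in> add_span ?T" "f (append_letter i ?u) \<in> add_span ?T"
      using deep_operator_bracketed_in_twice_bracketed[OF deep_operator.step[OF 2(2)] \<open>?u \<in> bracketed\<close>]
        deep_operator_bracketed_in_twice_bracketed[OF 2(2)] by (auto simp: twice_bracketed_def)
    then have "bracket f (append_letter i) ?u + f (append_letter i ?u) \<in> add_span ?T"
      by (rule add_span_add)
    then show ?thesis by (simp add: bracket_def 2(1))
  qed
qed simp

end

section \<open>Prime powers and binomial coefficients\<close>

text \<open>This follows from \<open>k * (p ^ e choose k) = p ^ e * (p ^ e - 1 choose k - 1)\<close>.\<close>

lemma prime_power_dvd_binomial:
  fixes p :: nat
  assumes p: "prime p" and k: "k = p ^ s * u" "\<not> p dvd u" "k > 0" and s: "s \<le> e"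
  shows "p ^ (e - s) dvd (p ^ e choose k)"
proof (cases "k \<le> p ^ e")
  case True
  have "p ^ s * p ^ (e - s) = p ^ e" using s by (simp flip: power_add)
  then have "p ^ s * (u * (p ^ e choose k)) = p ^ s * (p ^ (e - s) * ((p ^ e - 1) choose (k - 1)))"
    using times_binomial_minus1_eq[OF k(3), of "p ^ e"] k(1) by (metis mult.assoc)
  then have "u * (p ^ e choose k) = p ^ (e - s) * ((p ^ e - 1) choose (k - 1))"
    using p by (simp add: prime_gt_0_nat)
  then have "p ^ (e - s) dvd u * (p ^ e choose k)" by simp
  moreover have "coprime (p ^ (e - s)) u"
    using p k(2) by (simp add: prime_imp_coprime)
  ultimately show ?thesis by (simp add: coprime_dvd_mult_right_iff)
next
  case False
  then show ?thesis by (simp add: binomial_eq_0)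
qed

lemma prime_dvd_binomial_prime_power:
  fixes p :: nat
  assumes p: "prime p" and k: "0 < k" "k < p ^ e"
  shows "p dvd (p ^ e choose k)"
proof -
  obtain s u where u: "k = p ^ s * u" "\<not> p dvd u"
    using prime_power_canonical[OF p k(1)] by (metis mult.commute)
  then have "u > 0" using k by (cases u) auto
  then have "p ^ s \<le> k" using u by simp
  then have "p ^ s < p ^ e" using k by linarith
  then have "s < e" using prime_gt_1_nat[OF p] power_less_imp_less_exp by blast
  then have "p dvd p ^ (e - s)" by (simp add: dvd_power)
  then show ?thesis using prime_power_dvd_binomial[OF p u k(1), of e] \<open>s < e\<close> dvd_trans by fastforce
qed

lemma prime_power_ge_Suc: "prime (p::nat) \<Longrightarrow> k + 1 \<le> p ^ k"
proof (induction k)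
  case (Suc k)
  have "2 * p ^ k \<le> p * p ^ k" using prime_ge_2_nat[OF Suc.prems] by (intro mult_right_mono) auto
  moreover have "k + 1 \<le> p ^ k" using Suc by simp
  ultimately show ?case unfolding power_Suc by linarith
qed simp

lemma odd_prime_power_sum:
  assumes "odd (p::nat)"
  shows "p ^ a + p ^ b \<noteq> p ^ c"
proof
  assume "p ^ a + p ^ b = p ^ c"
  moreover have "even (p ^ a + p ^ b)" "odd (p ^ c)" using assms by simp_all
  ultimately show False by simp
qed

text \<open>The top term \<open>x Y ^ (q - 1)\<close> with \<open>q = p ^ (r + 1)\<close> has enough factors \<open>Y\<close>: one to reach \<open>V\<close>,
  then \<open>p * r\<close> to reach \<open>U\<close>, then \<open>p ^ 2\<close>.\<close>

lemma odd_prime_power_bound: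
  assumes p: "(p::nat) \<ge> 3" and r: "r \<ge> 2"
  shows "p ^ 2 + p * r + 2 \<le> p ^ (r + 1)"
proof -
  have "p + r + 1 \<le> p ^ r"
    using r
  proof (induction r rule: dec_induct)
    case base
    have "p * 3 \<le> p * p" using p by simp
    then have "p + 2 + 1 \<le> p * p" using p by linarith
    then show ?case by (simp add: power2_eq_square)
  next
    case (step k)
    have "3 * p ^ k \<le> p * p ^ k" using p by (intro mult_right_mono) auto
    then show ?case unfolding power_Suc using step.IH by linarith
  qed
  then have "p * (p + r + 1) \<le> p * p ^ r" by (rule mult_left_mono) simp
  moreover have "p * (p + r + 1) = p ^ 2 + p * r + p" "p * p ^ r = p ^ (r + 1)"
    by (simp_all add: power2_eq_square algebra_simps)
  ultimately show ?thesis using p by linarith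
qed

section \<open>Powers of products of generators\<close>

context repetition_free_group begin

text \<open>Passing from \<open>q\<close> to \<open>q + 1\<close> replaces the error \<open>s\<close> by \<open>s (1 + f) + 1\<close>, and Pascal's rule gives the binomial
  coefficients.\<close>

lemma gprod_times_generator_pow:
  assumes k: "k \<in> carrier G" and f: "acts_as k f" "additive f"
  shows "(k \<otimes> g z) [^] (q::nat)
    = k [^] q \<otimes> ev (\<Sum>j<q. frag_cmul (int (q choose Suc j)) ((f ^^ j) (frag_of [])))"
proof (induction q)
  case (Suc q)
  let ?t = "\<lambda>j. (f ^^ j) (frag_of [])"
  let ?s = "\<Sum>j<q. frag_cmul (int (q choose Suc j)) (?t j)"
  have "(k \<otimes> g z) [^] Suc q = (k [^] q \<otimes> ev ?s) \<otimes> (k \<otimes> g z)"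
    using Suc by simp
  also have "\<dots> = k [^] Suc q \<otimes> (inv k \<otimes> ev ?s \<otimes> k) \<otimes> ev (frag_of [])"
    using k by (simp add: group_word_simps ev_frag_of)
  also have "inv k \<otimes> ev ?s \<otimes> k = ev (?s + f ?s)"
    using f k by (simp add: acts_as_conj)
  also have "k [^] Suc q \<otimes> ev (?s + f ?s) \<otimes> ev (frag_of [])
      = k [^] Suc q \<otimes> ev (?s + f ?s + frag_of [])"
    using k by (simp add: ev_add m_assoc del: nat_pow_Suc)
  also have "?s + f ?s + frag_of [] = (\<Sum>j<Suc q. frag_cmul (int (Suc q choose Suc j)) (?t j))"
  proof -
    have "f ?s + frag_of [] = (\<Sum>j<Suc q. frag_cmul (int (q choose j)) (?t j))"
      by (subst sum.lessThan_Suc_shift)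
        (simp add: additive.sum[OF f(2)] additive_cmul[OF f(2)] add.commute)
    moreover have "?s = (\<Sum>j<Suc q. frag_cmul (int (q choose Suc j)) (?t j))"
      by (simp add: binomial_eq_0)
    moreover have "(\<Sum>j<Suc q. frag_cmul (int (Suc q choose Suc j)) (?t j))
        = (\<Sum>j<Suc q. frag_cmul (int (q choose Suc j)) (?t j)) + (\<Sum>j<Suc q. frag_cmul (int (q choose j)) (?t j))"
      by (simp add: frag_cmul_distrib sum.distrib add.commute del: sum.lessThan_Suc)
    ultimately show ?thesis by (simp only: add.assoc)
  qed
  finally show ?case .
qed simp

text \<open>The congruence \<open>(1 + f) ^ (p ^ t) \<equiv> 1 + f ^ (p ^ t)\<close> modulo \<open>p\<close>.\<close>

lemma submodule_frobenius:
  assumes p: "prime p" and S: "submodule S" and f: "additive f"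
    and m: "((\<lambda>m. m + f m) ^^ (p ^ t)) m - m \<in> S"
    and small: "\<And>j. frag_cmul (int p) ((f ^^ j) m) \<in> S"
  shows "(f ^^ (p ^ t)) m \<in> S"
proof -
  let ?c = "\<lambda>j. frag_cmul (int (p ^ t choose j)) ((f ^^ j) m)"
  have q: "p ^ t > 0" using p by (simp add: prime_gt_0_nat)
  have "(\<Sum>j\<in>{0<..<p ^ t}. ?c j) \<in> S"
  proof (rule submodule_sum[OF S])
    fix j assume "j \<in> {0<..<p ^ t}"
    then obtain c where "p ^ t choose j = c * p"
      using prime_dvd_binomial_prime_power[OF p, of j t] by (auto simp: dvd_def mult.commute)
    then have "?c j = frag_cmul (int c) (frag_cmul (int p) ((f ^^ j) m))" by simp
    then show "?c j \<in> S" using submodule_cmul[OF S small] by simp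
  qed
  moreover have "(\<Sum>j\<le>p ^ t. ?c j) = m + (\<Sum>j\<in>{0<..<p ^ t}. ?c j) + (f ^^ (p ^ t)) m"
  proof -
    have "{..p ^ t} = insert 0 (insert (p ^ t) {0<..<p ^ t})" using q by auto
    then show ?thesis using q by (simp add: add_ac)
  qed
  moreover have "(\<Sum>j\<le>p ^ t. ?c j) - m \<in> S"
    using m by (simp add: funpow_one_plus[OF f])
  ultimately show ?thesis
    using submodule_diff[OF S, of "(\<Sum>j\<le>p ^ t. ?c j) - m" "\<Sum>j\<in>{0<..<p ^ t}. ?c j"]
    by (simp only:) simp
qed

text \<open>The module \<open>U + p ^ j V\<close>.\<close>

definition level :: "nat \<Rightarrow> nat \<Rightarrow> word_module set" where
  "level p j = add_span (bracketed \<union> frag_cmul (int (p ^ j)) ` proper_words)"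

lemma null_subset_bracketed: "null \<subseteq> bracketed"
  using submodule_null[OF submodule_bracketed] by blast

lemma submodule_level: "submodule (level p j)"
  unfolding level_def
proof (rule submodule_span)
  fix i t assume "t \<in> bracketed \<union> frag_cmul (int (p ^ j)) ` proper_words"
  then show "append_letter i t \<in> add_span (bracketed \<union> frag_cmul (int (p ^ j)) ` proper_words)"
    using submodule_append_letter[OF submodule_bracketed] submodule_append_letter[OF submodule_proper_words]
    by (auto simp: additive_cmul[OF additive_append_letter] simp del: of_nat_power intro!: add_span.base)
qed (use null_subset_bracketed in auto)

lemma pow_generator: "acts_as (g i [^] (p::nat)) (\<lambda>m. frag_cmul (int p) (append_letter i m))"
  using acts_as_pow[OF lnc_in_letter_subgroup[of i "[i]"] _ additive_append_letter] acts_as_generator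
  by simp

text \<open>The kernel of the action on \<open>V / (U + p V)\<close> contains the derived subgroup by definition of \<open>U\<close>, and
  the powers \<open>g i ^ p\<close>, which act as \<open>1 + p X\<^sub>i\<close>. So it contains the \<open>p\<close>-th power of any product of
  generators.\<close>

lemma frobenius_proper_words:
  assumes p: "prime p" and v: "v \<in> proper_words"
  shows "(prod_operator is ^^ p) v \<in> level p 1"
proof -
  let ?f = "prod_operator is"
  let ?S = "level p 1"
  let ?P = "relative_centralizer (ev ` proper_words) (ev ` ?S)"
  note S = submodule_level[of p 1]
  have P: "?P \<lhd> G"
    by (intro normal_relative_centralizer normal_image_submodule submodule_level submodule_proper_words)
  have US: "u \<in> ?S" if "u \<in> bracketed" for u
    using that by (auto simp: level_def intro: add_span.base)
  have VS: "frag_cmul (int p) u \<in> ?S" if "u \<in> proper_words" for u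
    using that by (auto simp: level_def intro: add_span.base)
  have "lnc is \<in> ?P" if "length is \<ge> 2" for "is"
  proof -
    have "is \<noteq> []" using that by auto
    then show ?thesis
      using in_relative_centralizer_image[OF S lnc_closed acts_as_lnc] US ln_bracket_proper_words_in_bracketed[OF that]
      by simp
  qed
  then have "derived G (carrier G) \<subseteq> ?P"
    unfolding derived_eq_generate_lnc
    by (intro generate_subgroup_incl normal_imp_subgroup[OF P]) auto
  moreover have "g i [^] p \<in> ?P" for i
    using in_relative_centralizer_image[OF S _ pow_generator] VS append_letter_in_proper_words by simp
  ultimately have "gprod is [^] p \<in> ?P"
    by (intro gprod_pow_in_normal P)
  then have "((\<lambda>m. m + ?f m) ^^ p) v - v \<in> ?S"
    using in_relative_centralizer_image[OF S _ acts_as_pow_general[OF gprod_closed acts_as_gprod]] v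
    by simp
  then show ?thesis
    using submodule_frobenius[OF p S additive_prod_operator[of "is"], where t = 1 and m = v] VS
      submodule_funpow[OF submodule_proper_words submodule_prod_operator[OF submodule_proper_words] v] by simp
qed

lemma frobenius_iterate:
  assumes p: "prime p" and v: "v \<in> proper_words"
  shows "(prod_operator is ^^ (p * j)) v \<in> level p j"
proof (induction j)
  case 0
  then show ?case using v by (auto simp: level_def intro: add_span.base)
next
  case (Suc j)
  let ?f = "prod_operator is ^^ p"
  have add: "additive ?f" by (intro additive_funpow additive_prod_operator)
  have "?f m \<in> level p (Suc j)" if "m \<in> level p j" for m
    using that unfolding level_def[of p j] level_def[of p "Suc j"]
  proof (rule add_span_image[OF _ add])
    fix s assume "s \<in> bracketed \<union> frag_cmul (int (p ^ j)) ` proper_words"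
    then consider "s \<in> bracketed" | v where "v \<in> proper_words" "s = frag_cmul (int (p ^ j)) v" by blast
    then show "?f s \<in> add_span (bracketed \<union> frag_cmul (int (p ^ Suc j)) ` proper_words)"
    proof cases
      case 1
      then have "?f s \<in> bracketed"
        by (intro submodule_funpow[OF submodule_bracketed] submodule_prod_operator[OF submodule_bracketed])
      then show ?thesis by (auto intro: add_span.base)
    next
      case 2
      have "frag_cmul (int (p ^ j)) (?f v) \<in> add_span (bracketed \<union> frag_cmul (int (p ^ Suc j)) ` proper_words)"
      proof (rule add_span_image[OF _ additive_frag_cmul])
        show "?f v \<in> add_span (bracketed \<union> frag_cmul (int p) ` proper_words)"
          using frobenius_proper_words[OF p 2(1)] by (simp add: level_def)
        fix s assume "s \<in> bracketed \<union> frag_cmul (int p) ` proper_words"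
        then show "frag_cmul (int (p ^ j)) s \<in> add_span (bracketed \<union> frag_cmul (int (p ^ Suc j)) ` proper_words)"
          using submodule_cmul[OF submodule_bracketed]
          by (auto simp: mult.commute intro!: add_span.base)
      qed
      then show ?thesis using 2 additive_cmul[OF add] by simp
    qed
  qed
  from this[OF Suc] show ?case by (simp add: funpow_add)
qed

text \<open>The module \<open>p U + [U, \<gamma>\<^sub>2\<^sub>2]\<close>.\<close>

definition deep_level :: "nat \<Rightarrow> word_module set" where
  "deep_level p = add_span (frag_cmul (int p) ` bracketed \<union> twice_bracketed)"

lemma submodule_deep_level: "submodule (deep_level p)"
  unfolding deep_level_def
proof (rule submodule_span)
  show "null \<subseteq> frag_cmul (int p) ` bracketed \<union> twice_bracketed"
    using submodule_null[OF submodule_twice_bracketed] by blast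
  fix i t assume "t \<in> frag_cmul (int p) ` bracketed \<union> twice_bracketed"
  then show "append_letter i t \<in> add_span (frag_cmul (int p) ` bracketed \<union> twice_bracketed)"
    using submodule_append_letter[OF submodule_bracketed] submodule_append_letter[OF submodule_twice_bracketed]
    by (auto simp: additive_cmul[OF additive_append_letter] intro!: add_span.base)
qed

text \<open>The kernel \<open>P\<close> of the action on \<open>U / (p U + [U, \<gamma>\<^sub>2\<^sub>2])\<close> contains \<open>\<gamma>22\<close> and the \<open>p\<close>-th powers of
  the \<open>g i\<close> and of the \<open>lnc is\<close>, which act as \<open>1 + p f\<close>. So \<open>\<gamma>2\<close> has exponent \<open>p\<close> modulo \<open>P\<close>. The
  \<open>p\<close>-th power of a product of generators is in \<open>\<gamma>2 P\<close>, and its \<open>p\<close>-th power is then in \<open>P\<close>.\<close>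

lemma frobenius_bracketed:
  assumes p: "prime p" and u: "u \<in> bracketed"
  shows "(prod_operator is ^^ (p ^ 2)) u \<in> deep_level p"
proof -
  let ?f = "prod_operator is"
  let ?S = "deep_level p"
  let ?P = "relative_centralizer (ev ` bracketed) (ev ` ?S)"
  note S = submodule_deep_level[of p]
  have P: "?P \<lhd> G"
    by (intro normal_relative_centralizer normal_image_submodule submodule_deep_level submodule_bracketed)
  interpret P: normal ?P G by (rule P)
  have US: "frag_cmul (int p) u \<in> ?S" if "u \<in> bracketed" for u
    using that by (auto simp: deep_level_def intro: add_span.base)
  have U22S: "u \<in> ?S" if "u \<in> twice_bracketed" for u
    using that by (auto simp: deep_level_def intro: add_span.base)
  have gen: "g i [^] p \<in> ?P" for i
    using in_relative_centralizer_image[OF S _ pow_generator] US submodule_append_letter[OF submodule_bracketed]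
    by simp
  have \<gamma>2: "\<gamma>2 = generate G (lnc ` {is. length is \<ge> 2})"
    by (simp add: \<gamma>2_def derived_eq_generate_lnc)
  have "commutator G (lnc is) (lnc js) \<in> ?P" if "length is \<ge> 2" "length js \<ge> 2" for "is" js
  proof -
    have ne: "is \<noteq> []" "js \<noteq> []" using that by auto
    then have "acts_as (commutator G (lnc is) (lnc js)) (bracket (ln_bracket is) (ln_bracket js))"
      using acts_as_commutator[OF lnc_in_letter_subgroup acts_as_lnc additive_ln_bracket
        lnc_in_letter_subgroup acts_as_lnc additive_ln_bracket, of "hd is" "is" "hd js" js] by auto
    then show ?thesis
      using in_relative_centralizer_image[OF S] commutator_closed[OF lnc_closed lnc_closed]
        deep_operator_bracketed_in_twice_bracketed[OF deep_operator.base[OF that]] U22S by blast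
  qed
  then have \<gamma>22: "\<gamma>22 \<subseteq> ?P"
    unfolding \<gamma>22_def \<gamma>2 by (intro derived_generate_subset[OF P]) auto
  have lnc_pow: "lnc is [^] p \<in> ?P" if "length is \<ge> 2" for "is"
  proof -
    have "is \<noteq> []" using that by auto
    then have "acts_as (lnc is [^] p) (\<lambda>m. frag_cmul (int p) (ln_bracket is m))"
      using acts_as_pow[OF lnc_in_letter_subgroup acts_as_lnc additive_ln_bracket, of "hd is" "is"] by auto
    then show ?thesis
      using in_relative_centralizer_image[OF S nat_pow_closed[OF lnc_closed]]
        US submodule_ln_bracket[OF submodule_bracketed] by blast
  qed
  have \<gamma>2_pow: "h [^] p \<in> ?P" if "h \<in> \<gamma>2" for h
    using that unfolding \<gamma>2
  proof induction
    case (eng a b)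
    then have ab: "a \<in> \<gamma>2" "b \<in> \<gamma>2" by (simp_all add: \<gamma>2)
    then have "commutator G a b \<in> ?P"
      using \<gamma>22 commutator_in_derived[OF normal_imp_subgroup[OF normal_\<gamma>2]] by (auto simp: \<gamma>22_def)
    moreover have "a \<in> carrier G" "b \<in> carrier G"
      using ab normal_imp_subgroup[OF normal_\<gamma>2] subgroup.mem_carrier by metis+
    ultimately show ?case using pow_mult_in_normal[OF P] eng by blast
  next
    case (inv a)
    then show ?case using lnc_pow by (auto simp: nat_pow_inv)
  qed (use lnc_pow in auto)
  interpret \<gamma>2: normal \<gamma>2 G by (rule normal_\<gamma>2)
  have "gprod is [^] p \<in> \<gamma>2 <#> ?P"
  proof (rule gprod_pow_in_normal)
    show "\<gamma>2 <#> ?P \<lhd> G" by (rule normal_subgroup_set_mult_closed[OF normal_\<gamma>2 P])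
    show "derived G (carrier G) \<subseteq> \<gamma>2 <#> ?P"
    proof
      fix a assume "a \<in> derived G (carrier G)"
      then have "a \<in> \<gamma>2" by (simp add: \<gamma>2_def)
      then have "a \<otimes> \<one> \<in> \<gamma>2 <#> ?P" by (rule set_multI[OF _ P.one_closed])
      then show "a \<in> \<gamma>2 <#> ?P"
        unfolding r_one[OF \<gamma>2.mem_carrier[OF \<open>a \<in> \<gamma>2\<close>]] .
    qed
    fix i have "\<one> \<otimes> g i [^] p \<in> \<gamma>2 <#> ?P" by (rule set_multI[OF \<gamma>2.one_closed gen])
    then show "g i [^] p \<in> \<gamma>2 <#> ?P" by simp
  qed
  then obtain h k where hk: "h \<in> \<gamma>2" "k \<in> ?P" "gprod is [^] p = h \<otimes> k"
    unfolding set_mult_def by blast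
  have hkG: "h \<in> carrier G" "k \<in> carrier G" using hk by auto
  have "k [^] p \<in> ?P" using hk(2) by (rule subgroup_nat_pow_closed[OF P.subgroup_axioms])
  then have "(h \<otimes> k) [^] p \<in> ?P"
    using pow_mult_in_normal[OF P hkG commutator_in_normal(2)[OF P hkG hk(2)] \<gamma>2_pow[OF hk(1)]]
    by blast
  then have "gprod is [^] (p ^ 2) \<in> ?P"
    unfolding power2_eq_square nat_pow_pow[OF gprod_closed, symmetric] hk(3) .
  then have "((\<lambda>m. m + ?f m) ^^ (p ^ 2)) u - u \<in> ?S"
    using in_relative_centralizer_image[OF S _ acts_as_pow_general[OF gprod_closed acts_as_gprod]] u
    by simp
  then show ?thesis
    using submodule_frobenius[OF p S additive_prod_operator[of "is"], where t = 2 and m = u] US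
      submodule_funpow[OF submodule_bracketed submodule_prod_operator[OF submodule_bracketed] u] by simp
qed

end

section \<open>The error term\<close>

context repetition_free_group begin

lemma submodule_add_span:
  assumes "submodule S" "m \<in> add_span T" "T \<subseteq> S"
  shows "m \<in> S"
  using assms(2,3) by induction (auto intro: submodule_zero[OF assms(1)] submodule_diff[OF assms(1)])

text \<open>The \<open>\<Sum>k=1..q. (q choose k) x Y ^ (k - 1)\<close> of the introduction, with \<open>k = j + 1\<close>; the empty word is \<open>x\<close>.\<close>

definition error_term :: "nat list \<Rightarrow> nat \<Rightarrow> word_module" where
  "error_term is q = (\<Sum>j<q. frag_cmul (int (q choose Suc j)) ((prod_operator is ^^ j) (frag_of [])))"

text \<open>Each summand is treated according to the exact power \<open>p ^ s\<close> of \<open>p\<close> in its index \<open>k = j + 1\<close>. The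
  case \<open>s = r + 1\<close> is the top term alone, whose coefficient is \<open>1\<close>; it reaches the deep level by
  the number of its factors \<open>Y\<close>.\<close>

lemma error_term_in_deep_level:
  assumes p: "prime p" "p \<ge> 3" and r: "r \<ge> 2"
    and exponent: "\<And>i. g i [^] (p ^ r) = \<one>"
  shows "error_term is (p ^ (r + 1)) \<in> deep_level p"
  unfolding error_term_def
proof (rule submodule_sum[OF submodule_deep_level])
  let ?f = "prod_operator is" and ?q = "p ^ (r + 1)"
  have torsion: "frag_cmul (int (c * p ^ r)) m \<in> null" for c m
    using null_cmul[OF null_exponent[OF exponent], of "int c" m] by simp
  have null_deep: "m \<in> deep_level p" if "m \<in> null" for m
    using that submodule_null[OF submodule_deep_level] by blast
  have f_funpow_proper_words: "(?f ^^ Suc e) m \<in> proper_words" for e m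
    by (simp add: prod_operator_in_proper_words)
  fix j assume j: "j \<in> {..<?q}"
  obtain s u where u: "Suc j = p ^ s * u" "\<not> p dvd u"
    using prime_power_canonical[OF p(1), of "Suc j"] by (metis mult.commute zero_less_Suc)
  have u0: "u \<noteq> 0" using u(1) by (cases u) auto
  have "p ^ s \<le> Suc j" using u(1) u0 by simp
  also have "\<dots> \<le> ?q" using j by simp
  finally have s: "s \<le> r + 1"
    using prime_gt_1_nat[OF p(1)] power_increasing_iff by blast
  then obtain c where c: "?q choose Suc j = c * p ^ (r + 1 - s)"
    using prime_power_dvd_binomial[OF p(1) u _ s] by (auto simp: dvd_def mult.commute)
  consider "s \<le> 1" | "s \<ge> 2" "s \<le> r" | "s = r + 1" using s by linarith
  then show "frag_cmul (int (?q choose Suc j)) ((?f ^^ j) (frag_of [])) \<in> deep_level p"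
  proof cases
    \<comment> \<open>The coefficient is divisible by the exponent of the normal closure.\<close>
    case 1
    then have "p ^ (r + 1 - s) = p ^ (1 - s) * p ^ r" by (simp flip: power_add)
    then show ?thesis unfolding c using torsion[of "c * p ^ (1 - s)"] null_deep by (simp add: mult.assoc)
  next
    \<comment> \<open>There are \<open>s - 1\<close> factors \<open>Y ^ p\<close> after the first factor \<open>Y\<close>, so the term lies in
      \<open>U + p ^ (s - 1) V\<close>. The coefficient \<open>p ^ (r + 1 - s)\<close> sends \<open>U\<close> to \<open>p U\<close> and turns
      \<open>p ^ (s - 1)\<close> into \<open>p ^ r\<close>, which kills the second summand.\<close>
    case 2
    have "Suc (s - 1) * p \<le> p ^ (s - 1) * p"
      using prime_power_ge_Suc[OF p(1), of "s - 1"] by (intro mult_right_mono) auto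
    also have "\<dots> = p ^ s" using 2 by (simp flip: power_Suc2)
    also have "\<dots> \<le> Suc j" by fact
    finally have "p * (s - 1) + p \<le> Suc j" by (simp add: mult.commute)
    then have "p * (s - 1) + Suc 0 \<le> j" using p(2) by linarith
    then obtain e where e: "j = e + (p * (s - 1) + Suc 0)" by (metis add.commute le_Suc_ex)
    let ?m = "(?f ^^ (p * (s - 1))) (?f (frag_of []))"
    have "?m \<in> level p (s - 1)"
      by (rule frobenius_iterate[OF p(1) prod_operator_in_proper_words])
    then have "(?f ^^ e) ?m \<in> level p (s - 1)"
      using submodule_funpow[OF submodule_level, of p "s - 1" ?f ?m e]
        submodule_prod_operator[OF submodule_level] by blast
    then have "(?f ^^ j) (frag_of []) \<in> add_span (bracketed \<union> frag_cmul (int (p ^ (s - 1))) ` proper_words)"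
      unfolding level_def e by (simp only: funpow_add o_apply funpow.simps id_apply)
    then have "frag_cmul (int (c * p ^ (r + 1 - s))) ((?f ^^ j) (frag_of [])) \<in> deep_level p"
      unfolding deep_level_def
    proof (rule add_span_image[OF _ additive_frag_cmul])
      fix t assume "t \<in> bracketed \<union> frag_cmul (int (p ^ (s - 1))) ` proper_words"
      then consider "t \<in> bracketed" | v where "t = frag_cmul (int (p ^ (s - 1))) v" by blast
      then have "frag_cmul (int (c * p ^ (r + 1 - s))) t \<in> deep_level p"
      proof cases
        case 1
        have eq: "c * p ^ (r + 1 - s) = (c * p ^ (r - s)) * p" using 2 by (simp add: Suc_diff_le)
        have "frag_cmul (int (c * p ^ (r + 1 - s))) t = frag_cmul (int (c * p ^ (r - s))) (frag_cmul (int p) t)"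
          unfolding eq by simp
        moreover have "frag_cmul (int p) t \<in> deep_level p"
          using 1 by (auto simp: deep_level_def intro: add_span.base)
        ultimately show ?thesis using submodule_cmul[OF submodule_deep_level] by metis
      next
        case (2 v)
        have eq: "(c * p ^ (r + 1 - s)) * p ^ (s - 1) = c * p ^ r"
          using \<open>s \<ge> 2\<close> \<open>s \<le> r\<close> by (simp add: mult.assoc flip: power_add)
        have "frag_cmul (int (c * p ^ (r + 1 - s))) t = frag_cmul (int (c * p ^ r)) v"
          unfolding 2 frag_cmul_cmul of_nat_mult[symmetric] eq ..
        then show ?thesis using torsion null_deep by simp
      qed
      then show "frag_cmul (int (c * p ^ (r + 1 - s))) t \<in> add_span (frag_cmul (int p) ` bracketed \<union> twice_bracketed)"
        by (simp add: deep_level_def)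
    qed
    then show ?thesis unfolding c .
  next
    \<comment> \<open>With \<open>r\<close> factors \<open>Y ^ p\<close> the second summand \<open>p ^ r V\<close> is zero, which leaves an element of \<open>U\<close>.\<close>
    case 3
    then have "?q \<le> Suc j" using \<open>p ^ s \<le> Suc j\<close> by simp
    then have "p ^ 2 + p * r + 1 \<le> j" using odd_prime_power_bound[OF p(2) r] by linarith
    then obtain e where e: "j = e + (p ^ 2 + (p * r + Suc 0))"
      by (metis add.assoc add.commute le_Suc_ex Suc_eq_plus1 add_0)
    let ?m = "(?f ^^ (p * r)) (?f (frag_of []))"
    have "?m \<in> level p r"
      by (rule frobenius_iterate[OF p(1) prod_operator_in_proper_words])
    moreover have "bracketed \<union> frag_cmul (int (p ^ r)) ` proper_words \<subseteq> bracketed"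
      using torsion[of 1] null_subset_bracketed by auto
    ultimately have "?m \<in> bracketed" unfolding level_def by (rule submodule_add_span[OF submodule_bracketed])
    then have "(?f ^^ (p ^ 2)) ?m \<in> deep_level p" by (rule frobenius_bracketed[OF p(1)])
    then have "(?f ^^ e) ((?f ^^ (p ^ 2)) ?m) \<in> deep_level p"
      using submodule_funpow[OF submodule_deep_level, of p ?f "(?f ^^ (p ^ 2)) ?m" e]
        submodule_prod_operator[OF submodule_deep_level] by blast
    then have "(?f ^^ j) (frag_of []) \<in> deep_level p"
      unfolding e by (simp only: funpow_add o_apply funpow.simps id_apply)
    then show ?thesis by (rule submodule_cmul[OF submodule_deep_level])
  qed
qed

lemma ev_proper_words: "m \<in> proper_words \<Longrightarrow> ev m \<in> \<gamma>2"
  unfolding proper_words_def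
  by (erule ev_add_span[OF _ normal_imp_subgroup[OF normal_\<gamma>2]])
    (use normal_imp_subgroup[OF normal_\<gamma>2] in
      \<open>auto simp: ev_frag_of null_def subgroup.one_closed Suc_le_eq intro!: lnc_in_\<gamma>2\<close>)

lemma ev_bracketed: "m \<in> bracketed \<Longrightarrow> ev m \<in> \<gamma>22"
  unfolding bracketed_def
proof (erule ev_add_span[OF _ normal_imp_subgroup[OF normal_\<gamma>22]])
  fix s assume "s \<in> {ln_bracket is (frag_of w) |is w. 2 \<le> length is \<and> w \<noteq> []} \<union> null"
  then consider "s \<in> null" | "is" w where "s = ln_bracket is (frag_of w)" "2 \<le> length is" "w \<noteq> []" by blast
  then show "ev s \<in> \<gamma>22"
  proof cases
    case 1
    then show ?thesis
      using normal_imp_subgroup[OF normal_\<gamma>22] by (simp add: null_def subgroup.one_closed)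
  next
    case 2
    have "frag_of w \<in> proper_words" using 2 by (auto simp: proper_words_def intro: add_span.base)
    then have "commutator G (ev (frag_of w)) (lnc is) \<in> \<gamma>22"
      unfolding \<gamma>22_def using 2
      by (intro commutator_in_derived normal_imp_subgroup[OF normal_\<gamma>2] ev_proper_words lnc_in_\<gamma>2)
    moreover have "acts_as (lnc is) (ln_bracket is)" using 2 by (intro acts_as_lnc) auto
    ultimately show ?thesis using 2 by (simp add: acts_as_def)
  qed
qed

lemma ln_bracket_in_bracketed: "2 \<le> length is \<Longrightarrow> w \<noteq> [] \<Longrightarrow> ln_bracket is (frag_of w) \<in> bracketed"
  by (auto simp: bracketed_def intro!: add_span.base)

lemma ev_twice_bracketed: "m \<in> twice_bracketed \<Longrightarrow> ev m \<in> derived G \<gamma>22"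
proof -
  have sub: "subgroup (derived G \<gamma>22) G"
    using normal_imp_subgroup[OF derived_is_normal[OF normal_\<gamma>22]] .
  show "m \<in> twice_bracketed \<Longrightarrow> ev m \<in> derived G \<gamma>22"
    unfolding twice_bracketed_def
  proof (erule ev_add_span[OF _ sub])
    fix s assume "s \<in> {f (ln_bracket is (frag_of w)) |f d is w.
            deep_operator d f \<and> 2 \<le> length is \<and> w \<noteq> []} \<union> null"
    then consider "s \<in> null" | f d "is" w where "s = f (ln_bracket is (frag_of w))"
        "deep_operator d f" "2 \<le> length is" "w \<noteq> []" by blast
    then show "ev s \<in> derived G \<gamma>22"
    proof cases
      case 1
      then show ?thesis using sub by (simp add: null_def subgroup.one_closed)
    next
      case 2
      obtain h where h: "h \<in> \<gamma>22" "acts_as h f" using deep_operator_realised[OF 2(2)] by blast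
      then have "commutator G (ev (ln_bracket is (frag_of w))) h \<in> derived G \<gamma>22"
        using 2 by (intro commutator_in_derived normal_imp_subgroup[OF normal_\<gamma>22] ev_bracketed ln_bracket_in_bracketed)
      then show ?thesis using 2 h by (simp add: acts_as_def)
    qed
  qed
qed

lemma deep_level_decompose:
  assumes "m \<in> deep_level p"
  obtains a u where "a \<in> twice_bracketed" "u \<in> bracketed" "m = a + frag_cmul (int p) u"
proof -
  obtain a b where ab: "a \<in> add_span (frag_cmul (int p) ` bracketed)" "b \<in> add_span twice_bracketed" "m = a + b"
    using add_span_Un_decompose assms unfolding deep_level_def by blast
  have "b \<in> twice_bracketed" using submodule_add_span[OF submodule_twice_bracketed ab(2)] by blast
  moreover have "\<exists>u\<in>bracketed. a = frag_cmul (int p) u"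
    using ab(1)
  proof induction
    case (diff a b)
    then obtain u v where "u \<in> bracketed" "v \<in> bracketed" "a = frag_cmul (int p) u" "b = frag_cmul (int p) v" by blast
    then have "a - b = frag_cmul (int p) (u - v)"
      by (simp add: additive.diff[OF additive_frag_cmul])
    then show ?case using submodule_diff[OF submodule_bracketed \<open>u \<in> bracketed\<close> \<open>v \<in> bracketed\<close>] by blast
  qed (use submodule_zero[OF submodule_bracketed] in \<open>force+\<close>)
  ultimately show ?thesis using that ab(3) by (metis add.commute)
qed

text \<open>The inclusion \<open>U \<subseteq> \<gamma>\<^sub>2\<^sub>2\<close> puts \<open>[U, \<gamma>\<^sub>2\<^sub>2]\<close> into the first factor and \<open>p U\<close> into the third.\<close>

lemma ev_deep_level_derived:
  assumes "m \<in> deep_level p"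
  shows "ev m \<in> derived G \<gamma>22 <#> commutator_subgroup G (power_subgroup G \<gamma>2 p) \<gamma>22
            <#> power_subgroup G \<gamma>22 p"
proof -
  obtain a u where au: "a \<in> twice_bracketed" "u \<in> bracketed" "m = a + frag_cmul (int p) u"
    using deep_level_decompose[OF assms] .
  have "ev (frag_cmul (int p) u) \<in> power_subgroup G \<gamma>22 p"
    unfolding power_subgroup_def ev_cmul using ev_bracketed[OF au(2)] by (blast intro: generate.incl)
  moreover have "ev a \<otimes> \<one> \<in> derived G \<gamma>22 <#> commutator_subgroup G (power_subgroup G \<gamma>2 p) \<gamma>22"
    using ev_twice_bracketed[OF au(1)] generate.one unfolding commutator_subgroup_def by (rule set_multI)
  ultimately have "ev a \<otimes> \<one> \<otimes> ev (frag_cmul (int p) u) \<in> derived G \<gamma>22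
      <#> commutator_subgroup G (power_subgroup G \<gamma>2 p) \<gamma>22 <#> power_subgroup G \<gamma>22 p"
    by (rule set_multI[rotated])
  then show ?thesis by (simp add: au(3) ev_add)
qed

end

section \<open>Commutators whose length is not a prime power\<close>

text \<open>An abstract version of \<open>\<B>\<close>, with the exponent condition on lengths but without bounds on letters.\<close>

locale non_power_commutators = repetition_free_group G g z for G (structure) and g z +
  fixes p :: nat and B :: "'a set"
  assumes odd_p: "odd p"
    and subgroup_B: "subgroup B G"
    and lnc_in_B: "is \<noteq> [] \<Longrightarrow> \<nexists>t. length is = p ^ t \<Longrightarrow> lnc is \<in> B"
begin

abbreviation "BP \<equiv> commutator_subgroup G B (power_subgroup G \<gamma>2 p)"
abbreviation "BD \<equiv> commutator_subgroup G B \<gamma>22"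

lemma B_closed: "b \<in> B \<Longrightarrow> b \<in> carrier G"
  using subgroup_B by (rule subgroup.mem_carrier)

lemma \<gamma>2_closed: "a \<in> \<gamma>2 \<Longrightarrow> a \<in> carrier G"
  using normal_imp_subgroup[OF normal_\<gamma>2] by (rule subgroup.mem_carrier)

lemma \<gamma>22_closed: "a \<in> \<gamma>22 \<Longrightarrow> a \<in> carrier G"
  using normal_imp_subgroup[OF normal_\<gamma>22] by (rule subgroup.mem_carrier)

lemma power_subgroup_closed: "a \<in> power_subgroup G \<gamma>2 p \<Longrightarrow> a \<in> carrier G"
  unfolding power_subgroup_def
  by (erule generate_in_carrier[rotated]) (auto dest: \<gamma>2_closed)

lemma subgroup_BP: "subgroup BP G" and subgroup_BD: "subgroup BD G"
  unfolding commutator_subgroup_def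
  by (auto intro!: generate_is_subgroup commutator_closed dest: B_closed \<gamma>22_closed power_subgroup_closed)

lemma commutator_in_BP:
  assumes "b \<in> B" "a \<in> \<gamma>2"
  shows "commutator G b (a [^] p) \<in> BP" "commutator G (a [^] p) b \<in> BP"
proof -
  have "a [^] p \<in> power_subgroup G \<gamma>2 p"
    unfolding power_subgroup_def using assms(2) by (blast intro: generate.incl)
  then show 1: "commutator G b (a [^] p) \<in> BP"
    unfolding commutator_subgroup_def using assms(1) by (blast intro: generate.incl)
  show "commutator G (a [^] p) b \<in> BP"
    using subgroup.m_inv_closed[OF subgroup_BP 1] assms by (simp add: inv_commutator B_closed \<gamma>2_closed)
qed

lemma commutator_in_BD:
  assumes "b \<in> B" "a \<in> \<gamma>22"
  shows "commutator G b a \<in> BD" "commutator G a b \<in> BD"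
proof -
  show 1: "commutator G b a \<in> BD"
    unfolding commutator_subgroup_def using assms by (blast intro: generate.incl)
  show "commutator G a b \<in> BD"
    using subgroup.m_inv_closed[OF subgroup_BD 1] assms by (simp add: inv_commutator B_closed \<gamma>22_closed)
qed

text \<open>The elements of \<open>B\<close>, \<open>BP\<close> and \<open>BD\<close> are taken inside the abelian normal closure of \<open>g z\<close>. There the
  products form a subgroup, which the set \<open>B <#> BP <#> BD\<close> itself need not be.\<close>

definition B_products :: "word_module set" where
  "B_products = {b + c + d | b c d. ev b \<in> B \<and> ev c \<in> BP \<and> ev d \<in> BD}"

lemma one_in_subgroups: "\<one> \<in> B" "\<one> \<in> BP" "\<one> \<in> BD"
  using subgroup_B subgroup_BP subgroup_BD by (auto intro: subgroup.one_closed)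

lemma B_productsI:
  "ev m \<in> B \<Longrightarrow> m \<in> B_products" "ev m \<in> BP \<Longrightarrow> m \<in> B_products" "ev m \<in> BD \<Longrightarrow> m \<in> B_products"
proof -
  note [simp] = one_in_subgroups
  show "ev m \<in> B \<Longrightarrow> m \<in> B_products"
    unfolding B_products_def by (intro CollectI exI[of _ m] exI[of _ 0]) simp
  show "ev m \<in> BP \<Longrightarrow> m \<in> B_products"
    unfolding B_products_def
    by (rule CollectI, rule exI[of _ 0], rule exI[of _ m], rule exI[of _ 0]) simp
  show "ev m \<in> BD \<Longrightarrow> m \<in> B_products"
    unfolding B_products_def
    by (rule CollectI, rule exI[of _ 0], rule exI[of _ 0], rule exI[of _ m]) simp
qed

lemma B_products_null: "m \<in> null \<Longrightarrow> m \<in> B_products"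
  using B_productsI(1) one_in_subgroups by (simp add: null_def)

lemma B_products_diff:
  assumes "m \<in> B_products" "m' \<in> B_products"
  shows "m - m' \<in> B_products"
proof -
  obtain b c d where m: "m = b + c + d" "ev b \<in> B" "ev c \<in> BP" "ev d \<in> BD"
    using assms(1) unfolding B_products_def by blast
  obtain b' c' d' where m': "m' = b' + c' + d'" "ev b' \<in> B" "ev c' \<in> BP" "ev d' \<in> BD"
    using assms(2) unfolding B_products_def by blast
  have "m - m' = (b - b') + (c - c') + (d - d')" unfolding m(1) m'(1) by simp
  moreover have "ev (b - b') \<in> B" "ev (c - c') \<in> BP" "ev (d - d') \<in> BD"
    unfolding ev_diff using m m' subgroup_B subgroup_BP subgroup_BD
    by (blast intro: subgroup.m_closed subgroup.m_inv_closed)+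
  ultimately show ?thesis unfolding B_products_def by blast
qed

lemma B_products_add_span: "m \<in> add_span T \<Longrightarrow> T \<subseteq> B_products \<Longrightarrow> m \<in> B_products"
  by (induction rule: add_span.induct) (auto intro: B_products_diff B_products_null null_zero)

lemma words_in_B:
  assumes "m \<in> add_span (words_of_length k)" "\<nexists>t. Suc k = p ^ t"
  shows "ev m \<in> B"
  using assms(1)
proof (rule ev_add_span[OF _ subgroup_B])
  fix s assume "s \<in> words_of_length k"
  then obtain w where "s = frag_of w" "length w = k" by (auto simp: words_of_length_def)
  then show "ev s \<in> B" using assms(2) lnc_in_B[of "z # w"] by (simp add: ev_frag_of)
qed

lemma not_both_powers:
  assumes "Suc (k + d) = p ^ t"
  shows "(\<nexists>t. Suc k = p ^ t) \<or> (\<nexists>t. d = p ^ t)"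
  using assms odd_prime_power_sum[OF odd_p] by (metis add_Suc)

text \<open>A generator is \<open>[a, c] ^ p\<close> with \<open>a\<close> of length \<open>Suc (length w)\<close> and \<open>c\<close> of length \<open>length is\<close>. If the total
  length is not a power of \<open>p\<close>, it is in \<open>B\<close>. Otherwise it equals \<open>[a, c ^ p]\<close> with \<open>a \<in> B\<close>, or
  \<open>[a ^ p, c]\<close> with \<open>c \<in> B\<close>.\<close>

lemma cmul_bracketed_in_B_products:
  assumes "u \<in> bracketed"
  shows "frag_cmul (int p) u \<in> B_products"
proof -
  have gens: "frag_cmul (int p) s \<in> add_span B_products"
    if s: "s \<in> {ln_bracket is (frag_of w) | is w. length is \<ge> 2 \<and> w \<noteq> []} \<union> null" for s
  proof (rule add_span.base)
    consider "s \<in> null" | "is" w where "s = ln_bracket is (frag_of w)" "length is \<ge> 2" "w \<noteq> []"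
      using s by blast
    then show "frag_cmul (int p) s \<in> B_products"
    proof cases
      case 1
      then show ?thesis by (intro B_products_null null_cmul)
    next
      case 2
      note s_eq = 2(1) and w_ne = 2(3)
      have ne: "is \<noteq> []" using 2 by auto
      have lnc: "lnc is \<in> \<gamma>2" using 2 by (intro lnc_in_\<gamma>2)
      have w: "frag_of w \<in> add_span (words_of_length (length w))"
        by (auto simp: words_of_length_def intro: add_span.base)
      consider "\<nexists>t. Suc (length w + length is) = p ^ t" | "\<nexists>t. Suc (length w) = p ^ t"
        | "\<nexists>t. length is = p ^ t"
        using not_both_powers by blast
      then show ?thesis
      proof cases
        case 1
        have "s \<in> add_span (words_of_length (length w + length is))"
          unfolding s_eq by (rule ln_bracket_words[OF w])
        then show ?thesis using words_in_B[OF add_span_cmul 1] B_productsI(1) by blast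
      next
        case 2
        have "acts_as (lnc is [^] p) (\<lambda>m. frag_cmul (int p) (ln_bracket is m))"
          using acts_as_pow[OF lnc_in_letter_subgroup acts_as_lnc additive_ln_bracket, of "hd is" "is"] ne
          by auto
        then have "ev (frag_cmul (int p) s) = commutator G (ev (frag_of w)) (lnc is [^] p)"
          by (simp add: acts_as_def s_eq)
        then show ?thesis using commutator_in_BP(1)[OF words_in_B[OF w 2] lnc] B_productsI(2) by simp
      next
        case 3
        have wV: "ev (frag_of w) \<in> \<gamma>2"
          using w_ne by (intro ev_proper_words) (auto simp: proper_words_def intro: add_span.base)
        have "commutator G (ev (frag_cmul (int p) (frag_of w))) (lnc is) = ev (frag_cmul (int p) s)"
          using acts_as_lnc[OF ne]
          by (simp add: acts_as_def s_eq additive_cmul[OF additive_ln_bracket])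
        then show ?thesis
          using commutator_in_BP(2)[OF lnc_in_B[OF ne 3] wV] B_productsI(2) by (simp add: ev_cmul)
      qed
    qed
  qed
  have "frag_cmul (int p) u \<in> add_span B_products"
    using assms unfolding bracketed_def by (rule add_span_image[OF _ additive_frag_cmul gens])
  then show ?thesis by (rule B_products_add_span) simp
qed

text \<open>A generator is \<open>[u, h]\<close> with \<open>u, h \<in> \<gamma>22\<close> homogeneous. If the degree of \<open>h\<close> is the one that is not a
  power of \<open>p\<close>, then \<open>h\<close> itself need not be in \<open>B\<close>; its operator is a combination of
  operators of left-normalized commutators of that degree, and these are in \<open>B\<close>.\<close>

lemma twice_bracketed_in_B_products:
  assumes "m \<in> twice_bracketed"
  shows "m \<in> B_products"
  using assms unfolding twice_bracketed_def
proof (rule B_products_add_span, intro subsetI)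
  fix s assume "s \<in> {f (ln_bracket is (frag_of w)) | f d is w.
            deep_operator d f \<and> length is \<ge> 2 \<and> w \<noteq> []} \<union> null"
  then consider "s \<in> null" | f e "is" w where "s = f (ln_bracket is (frag_of w))"
      "deep_operator e f" "length is \<ge> 2" "w \<noteq> []"
    by blast
  then show "s \<in> B_products"
  proof cases
    case 1
    then show ?thesis by (rule B_products_null)
  next
    case 2
    let ?u = "ln_bracket is (frag_of w)"
    let ?k = "length w + length is"
    have w: "frag_of w \<in> add_span (words_of_length (length w))"
      by (auto simp: words_of_length_def intro: add_span.base)
    have u: "?u \<in> add_span (words_of_length ?k)" by (rule ln_bracket_words[OF w])
    have u22: "ev ?u \<in> \<gamma>22" using 2 by (intro ev_bracketed ln_bracket_in_bracketed)
    consider "\<nexists>t. Suc (?k + e) = p ^ t" | "\<nexists>t. Suc ?k = p ^ t" | "\<nexists>t. e = p ^ t"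
      using not_both_powers by blast
    then show ?thesis
    proof cases
      case 1
      then show ?thesis
        using words_in_B[OF deep_operator_words[OF 2(2) u] 1] B_productsI(1) by (simp add: 2(1))
    next
      case nonpower: 2
      obtain h where h: "h \<in> \<gamma>22" "acts_as h f" using deep_operator_realised[OF 2(2)] by blast
      have "commutator G (ev ?u) h \<in> BD"
        by (rule commutator_in_BD(1)[OF words_in_B[OF u nonpower] h(1)])
      then show ?thesis using h(2) B_productsI(3) by (simp add: acts_as_def 2(1))
    next
      case 3
      have "lie_operator e f" "e \<ge> 1" using lie_operator_deep[OF 2(2)] by auto
      from this(1) have "ev (f ?u) \<in> BD"
      proof induction
        case zero
        then show ?case using one_in_subgroups by simp
      next
        case (base js)
        have ne: "js \<noteq> []" using base \<open>e \<ge> 1\<close> by auto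
        have "lnc js \<in> B" using 3 base by (intro lnc_in_B[OF ne]) simp
        then have "commutator G (ev ?u) (lnc js) \<in> BD" by (rule commutator_in_BD(2)[OF _ u22])
        then show ?case using acts_as_lnc[OF ne] by (simp add: acts_as_def)
      next
        case (diff f h)
        then show ?case using subgroup_BD by (simp add: ev_diff subgroup.m_closed subgroup.m_inv_closed)
      qed
      then show ?thesis using B_productsI(3) by (simp add: 2(1))
    qed
  qed
qed

lemma ev_deep_level_B:
  assumes "m \<in> deep_level p"
  shows "ev m \<in> B <#> BP <#> BD"
proof -
  have "frag_cmul (int p) ` bracketed \<union> twice_bracketed \<subseteq> B_products"
    using cmul_bracketed_in_B_products twice_bracketed_in_B_products by blast
  then have "m \<in> B_products" using assms B_products_add_span unfolding deep_level_def by blast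
  then obtain b c d where "m = b + c + d" "ev b \<in> B" "ev c \<in> BP" "ev d \<in> BD"
    unfolding B_products_def by blast
  then show ?thesis by (simp add: ev_add set_multI)
qed

lemma gprod_power_error:
  assumes p: "prime p" and r: "r > 1" and exponent: "\<And>i. g i [^] (p ^ r) = \<one>"
  shows "\<exists>\<gamma> \<in> carrier G.
      gprod (is @ [z]) [^] (p ^ (r + 1)) = gprod is [^] (p ^ (r + 1)) \<otimes> \<gamma>
    \<and> \<gamma> \<in> derived G \<gamma>22 <#> commutator_subgroup G (power_subgroup G \<gamma>2 p) \<gamma>22
          <#> power_subgroup G \<gamma>22 p
    \<and> \<gamma> \<in> B <#> BP <#> BD"
proof -
  have "p \<noteq> 2" using odd_p by auto
  then have "p \<ge> 3" using prime_ge_2_nat[OF p] by linarith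
  then have deep: "error_term is (p ^ (r + 1)) \<in> deep_level p"
    using p r exponent by (intro error_term_in_deep_level) auto
  have "gprod (is @ [z]) [^] (p ^ (r + 1))
      = gprod is [^] (p ^ (r + 1)) \<otimes> ev (error_term is (p ^ (r + 1)))"
    unfolding gprod_snoc error_term_def
    by (rule gprod_times_generator_pow[OF gprod_closed acts_as_gprod additive_prod_operator])
  then show ?thesis
    using ev_deep_level_derived[OF deep] ev_deep_level_B[OF deep] ev_closed by blast
qed

end

section \<open>The Cohen group\<close>

context group begin

lemma ln_commutator_one:
  "set xs \<subseteq> carrier G \<Longrightarrow> \<one> \<in> set xs \<Longrightarrow> ln_commutator G xs = \<one>"
proof (induction xs rule: rev_induct)
  case (snoc x xs)
  show ?case
  proof (cases "xs = []")
    case True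
    then show ?thesis using snoc by simp
  next
    case False
    have "ln_commutator G (xs @ [x]) = commutator G (ln_commutator G xs) x"
      using False by (cases xs) auto
    moreover have "ln_commutator G xs \<in> carrier G" using snoc by (intro ln_commutator_closed) auto
    ultimately show ?thesis using snoc by (auto simp: commutator_def)
  qed
qed simp

end

lemma (in group_hom) hom_ln_commutator:
  assumes "set xs \<subseteq> carrier G"
  shows "h (ln_commutator G xs) = ln_commutator H (map h xs)"
  using assms
proof (induction xs rule: rev_induct)
  case (snoc x xs)
  show ?case
  proof (cases "xs = []")
    case False
    have "ln_commutator G (xs @ [x]) = commutator G (ln_commutator G xs) x"
      "ln_commutator H (map h (xs @ [x])) = commutator H (ln_commutator H (map h xs)) (h x)"
      using False by (cases xs; auto)+
    moreover have "ln_commutator G xs \<in> carrier G" using snoc by (intro G.ln_commutator_closed) auto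
    ultimately show ?thesis using snoc by (simp add: commutator_def)
  qed simp
qed simp

text \<open>Extended by \<open>\<one>\<close> to all indices, as \<open>repetition_free_group\<close> requires.\<close>

definition padded_gen :: "nat \<Rightarrow> nat \<Rightarrow> nat \<Rightarrow> nat letter list set" where
  "padded_gen n q i = (if i \<in> {1..n} then cohen_gen n q i else \<one>\<^bsub>cohen_group n q\<^esub>)"

lemma cohen_coset_hom:
  "group_hom (free_group {1..n}) (cohen_group n q) (\<lambda>w. cohen_kernel n q #>\<^bsub>free_group {1..n}\<^esub> w)"
  unfolding group_hom_def group_hom_axioms_def
  using group_free_group group_cohen_group normal.r_coset_hom_Mod[OF cohen_kernel_normal]
  by (simp add: cohen_group_def)

lemma relator_coset:
  assumes "w \<in> cohen_relators n q"
  shows "cohen_kernel n q #>\<^bsub>free_group {1..n}\<^esub> w = \<one>\<^bsub>cohen_group n q\<^esub>"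
proof -
  let ?F = "free_group {1..n}"
  interpret F: group ?F by (rule group_free_group)
  have "w \<in> cohen_kernel n q"
    unfolding cohen_kernel_def using F.normal_closure_normal(2)[OF cohen_relators_closed] assms by blast
  then have "cohen_kernel n q #>\<^bsub>?F\<^esub> w = cohen_kernel n q"
    using F.coset_join2 normal_imp_subgroup[OF cohen_kernel_normal] subgroup.mem_carrier by metis
  then show ?thesis by (simp add: cohen_group_def FactGroup_def)
qed

text \<open>A reduced word is the product of its letters, and each letter is a free generator or the inverse of
  one.\<close>

lemma cohen_group_generated:
  "carrier (cohen_group n q) = generate (cohen_group n q) (range (padded_gen n q))"
proof
  let ?F = "free_group {1..n}" and ?K = "cohen_group n q"
  let ?\<pi> = "\<lambda>w. cohen_kernel n q #>\<^bsub>?F\<^esub> w"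
  interpret \<pi>: group_hom ?F ?K ?\<pi> by (rule cohen_coset_hom)
  have closed: "range (padded_gen n q) \<subseteq> carrier ?K"
    using cohen_gen_closed by (auto simp: padded_gen_def)
  then show "generate ?K (range (padded_gen n q)) \<subseteq> carrier ?K" by (rule \<pi>.H.generate_incl)
  have letter: "?\<pi> [(i, b)] \<in> generate ?K (range (padded_gen n q))" if i: "i \<in> {1..n}" for i b
  proof -
    have gen: "?\<pi> (free_gen i) = padded_gen n q i" using i by (simp add: padded_gen_def cohen_gen_def)
    show ?thesis
    proof (cases b)
      case True
      then show ?thesis using gen by (auto simp: free_gen_def intro!: generate.incl)
    next
      case False
      have c: "[(i, False)] \<in> carrier ?F" "free_gen i \<in> carrier ?F"
        using i free_gen_closed[OF i] by (auto simp: free_group_def reduced_word_def)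
      have "[(i, False)] \<otimes>\<^bsub>?F\<^esub> free_gen i = \<one>\<^bsub>?F\<^esub>"
        by (simp add: free_group_def free_gen_def letter_inv_def)
      then have "[(i, False)] = inv\<^bsub>?F\<^esub> free_gen i"
        using c \<pi>.G.inv_equality by metis
      then have "?\<pi> [(i, False)] = inv\<^bsub>?K\<^esub> padded_gen n q i"
        using \<pi>.hom_inv[OF c(2)] unfolding gen by (simp only:)
      then show ?thesis using False by (auto intro: generate.inv)
    qed
  qed
  have "?\<pi> w \<in> generate ?K (range (padded_gen n q))" if "w \<in> carrier ?F" for w
    using that
  proof (induction w)
    case Nil
    have "?\<pi> [] = \<one>\<^bsub>?K\<^esub>" using \<pi>.hom_one by (simp add: free_group_def)
    then show ?case by (simp add: generate.one)
  next
    case (Cons l w)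
    then have l: "[l] \<in> carrier ?F" "w \<in> carrier ?F" "fst l \<in> {1..n}"
      by (auto simp: free_group_def reduced_word_def successively_Cons)
    have "push_letter l w = l # w"
      using Cons.prems by (cases w) (auto simp: free_group_def reduced_word_Cons)
    then have "l # w = [l] \<otimes>\<^bsub>?F\<^esub> w" by (simp add: free_group_def)
    then have "?\<pi> (l # w) = ?\<pi> [l] \<otimes>\<^bsub>?K\<^esub> ?\<pi> w" using l by (metis \<pi>.hom_mult)
    then show ?case using Cons.IH[OF l(2)] letter[OF l(3), of "snd l"] by (simp add: generate.eng)
  qed
  then show "carrier ?K \<subseteq> generate ?K (range (padded_gen n q))"
    by (auto simp: cohen_group_def FactGroup_def RCOSETS_def)
qed

lemma cohen_repetition_free_group: "repetition_free_group (cohen_group n q) (padded_gen n q)"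
proof -
  let ?F = "free_group {1..n}" and ?K = "cohen_group n q"
  let ?\<pi> = "\<lambda>w. cohen_kernel n q #>\<^bsub>?F\<^esub> w"
  interpret \<pi>: group_hom ?F ?K ?\<pi> by (rule cohen_coset_hom)
  have closed: "padded_gen n q i \<in> carrier ?K" for i
    using cohen_gen_closed by (auto simp: padded_gen_def)
  have "ln_commutator ?K (map (padded_gen n q) is) = \<one>\<^bsub>?K\<^esub>" if "\<not> distinct is" for "is"
  proof (cases "set is \<subseteq> {1..n}")
    case True
    have "set (map free_gen is) \<subseteq> carrier ?F" using True free_gen_closed[of _ "{1..n}"] by auto
    then have "ln_commutator ?K (map ?\<pi> (map free_gen is)) = ?\<pi> (ln_commutator ?F (map free_gen is))"
      by (rule \<pi>.hom_ln_commutator[symmetric])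
    also have "\<dots> = \<one>\<^bsub>?K\<^esub>"
      using that True by (intro relator_coset) (unfold cohen_relators_def Let_def, blast)
    also have "map ?\<pi> (map free_gen is) = map (padded_gen n q) is"
      using True by (auto simp: padded_gen_def cohen_gen_def)
    finally show ?thesis .
  next
    case False
    then obtain i where "i \<in> set is" "i \<notin> {1..n}" by blast
    then have "\<one>\<^bsub>?K\<^esub> \<in> set (map (padded_gen n q) is)" by (force simp: padded_gen_def)
    then show ?thesis using closed by (intro \<pi>.H.ln_commutator_one) auto
  qed
  then show ?thesis
    by (intro repetition_free_group.intro repetition_free_group_axioms.intro group_cohen_group
        closed cohen_group_generated)
qed

lemma padded_gen_exponent: "padded_gen n q i [^]\<^bsub>cohen_group n q\<^esub> q = \<one>\<^bsub>cohen_group n q\<^esub>"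
proof -
  let ?F = "free_group {1..n}" and ?K = "cohen_group n q"
  let ?\<pi> = "\<lambda>w. cohen_kernel n q #>\<^bsub>?F\<^esub> w"
  interpret \<pi>: group_hom ?F ?K ?\<pi> by (rule cohen_coset_hom)
  show ?thesis
  proof (cases "i \<in> {1..n}")
    case True
    have "?\<pi> (free_gen i [^]\<^bsub>?F\<^esub> q) = \<one>\<^bsub>?K\<^esub>"
      using True by (intro relator_coset) (unfold cohen_relators_def Let_def, blast)
    then show ?thesis
      using True \<pi>.hom_nat_pow[OF free_gen_closed[OF True]] by (simp add: padded_gen_def cohen_gen_def)
  next
    case False
    then have "padded_gen n q i = \<one>\<^bsub>?K\<^esub>" unfolding padded_gen_def by (rule if_not_P)
    then show ?thesis by simp
  qed
qed

theorem proposition2p7: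
  fixes p n r :: nat and K :: "nat letter list set monoid"
    and B \<gamma>2 \<gamma>22 \<gamma>222 :: "nat letter list set set"
  assumes "prime p" and "odd p" and "n \<ge> 1" and "r > 1"
    and "K = cohen_group (n + 1) (p ^ r)"
    and "\<gamma>2 = derived K (carrier K)"
    and "\<gamma>22 = derived K \<gamma>2"
    and "\<gamma>222 = derived K \<gamma>22"
    and "B = cohen_B p r (n + 1)"
  shows "\<exists>\<gamma> \<in> carrier K.
      cohen_prod (n + 1) (p ^ r) (n + 1) [^]\<^bsub>K\<^esub> (p ^ (r + 1))
        = cohen_prod (n + 1) (p ^ r) n [^]\<^bsub>K\<^esub> (p ^ (r + 1)) \<otimes>\<^bsub>K\<^esub> \<gamma>
    \<and> \<gamma> \<in> \<gamma>222 <#>\<^bsub>K\<^esub> commutator_subgroup K (power_subgroup K \<gamma>2 p) \<gamma>22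
              <#>\<^bsub>K\<^esub> power_subgroup K \<gamma>22 p
    \<and> \<gamma> \<in> B <#>\<^bsub>K\<^esub> commutator_subgroup K B (power_subgroup K \<gamma>2 p)
              <#>\<^bsub>K\<^esub> commutator_subgroup K B \<gamma>22"
proof -
  let ?N = "n + 1" and ?q = "p ^ r"
  let ?g = "padded_gen ?N ?q"
  interpret K: repetition_free_group K ?g ?N
    unfolding assms(5) by (rule cohen_repetition_free_group)
  have B_gens: "{ln_commutator K (map (cohen_gen ?N ?q) is) | is.
        is \<noteq> [] \<and> set is \<subseteq> {1..?N} \<and> (\<nexists>t. length is = p ^ t)} \<subseteq> carrier K"
    using cohen_gen_closed[of _ ?N ?q] unfolding assms(5)[symmetric]
    by (auto simp: subset_iff intro!: K.ln_commutator_closed)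
  interpret K: non_power_commutators K ?g ?N p B
  proof (intro non_power_commutators.intro non_power_commutators_axioms.intro)
    show "repetition_free_group K ?g" by (rule K.repetition_free_group_axioms)
    show "odd p" by fact
    show "subgroup B K"
      unfolding assms(9) cohen_B_def assms(5)[symmetric] by (rule K.generate_is_subgroup[OF B_gens])
    fix "is" :: "nat list" assume "is": "is \<noteq> []" "\<nexists>t. length is = p ^ t"
    show "K.lnc is \<in> B"
    proof (cases "set is \<subseteq> {1..?N}")
      case True
      then have map: "map ?g is = map (cohen_gen ?N ?q) is" by (auto simp: padded_gen_def)
      have "K.lnc is = ln_commutator K (map (cohen_gen ?N ?q) is)"
        unfolding K.lnc_def map ..
      then show ?thesis
        unfolding assms(9) cohen_B_def assms(5)[symmetric] using "is" True by (blast intro: generate.incl)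
    next
      case False
      then obtain i where "i \<in> set is" "i \<notin> {1..?N}" by blast
      then have "\<one>\<^bsub>K\<^esub> \<in> set (map ?g is)" by (force simp: padded_gen_def assms(5))
      then have "K.lnc is = \<one>\<^bsub>K\<^esub>"
        unfolding K.lnc_def using K.g_closed by (intro K.ln_commutator_one) (unfold set_map, blast+)
      then show ?thesis unfolding assms(9) cohen_B_def assms(5)[symmetric] by (simp add: generate.one)
    qed
  qed
  have prod: "cohen_prod ?N ?q m = K.gprod [1..<Suc m]" if "m \<le> ?N" for m
    unfolding cohen_prod_def K.gprod_def assms(5)[symmetric]
    using that by (intro foldr_cong) (auto simp: padded_gen_def)
  have "[1..<Suc ?N] = [1..<Suc n] @ [?N]" by simp
  then have prods: "cohen_prod ?N ?q ?N = K.gprod ([1..<Suc n] @ [?N])"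
    "cohen_prod ?N ?q n = K.gprod [1..<Suc n]"
    using prod[of ?N] prod[of n] by (simp_all only: le_add1 order_refl)
  have exponent: "?g i [^]\<^bsub>K\<^esub> ?q = \<one>\<^bsub>K\<^esub>" for i
    unfolding assms(5) by (rule padded_gen_exponent)
  have \<gamma>: "\<gamma>2 = K.\<gamma>2" "\<gamma>22 = K.\<gamma>22" "\<gamma>222 = derived K K.\<gamma>22"
    unfolding assms(6-8) K.\<gamma>2_def K.\<gamma>22_def by (rule refl)+
  show ?thesis
    unfolding \<gamma> prods by (rule K.gprod_power_error[OF assms(1,4) exponent])
qed

end
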